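(* Let $k \geq 0$ be an integer and let $f$ be the normalized extremal quasimodular form of weight $6k+4$ and depth $1$. Then every Fourier coefficient of $f$ lies in $\mathbb{Z}\big[\frac{1}{p} : p \text{ prime},\ p < 6k\big]$, i.e. $f \in \mathbb{Z}\big[\frac{1}{p} : p < 6k\big][[q]]$.
   Context: Let $\mathbb{H}$ be the upper half-plane, $z\in\mathbb{H}$, $q=e^{2\pi i z}$, $\sigma_j(n)=\sum_{d\mid n}d^j$. The Eisenstein series are $E_2=1-24\sum_{n\ge1}\sigma_1(n)q^n$, $E_4=1+240\sum_{n\ge1}\sigma_3(n)q^n$, $E_6=1-504\sum_{n\ge1}\sigma_5(n)q^n$. For an integer $w$, $\mathrm{M}_w$ denotes the space of holomorphic modular forms of weight $w$ for $\mathrm{SL}_2(\mathbb{Z})$ (with $\mathrm{M}_w=\{0\}$ for $w<0$). For even $w\ge 0$ let $\widetilde{\mathrm{M}}_{1,w}=\{f_0+f_1E_2 : f_0\in \mathrm{M}_w,\ f_1\in\mathrm{M}_{w-2}\}$; an element $f_0+f_1E_2$ with $f_1\neq 0$ is a quasimodular form of weight $w$ and depth $1$. Let $m=\dim_{\mathbb{C}}\widetilde{\mathrm{M}}_{1,w}$. A quasimodular form $f=\sum_{n\ge0}a_nq^n$ of weight $w$ and depth exactly $1$ is called extremal if $a_0=\dots=a_{m-2}=0$ and $a_{m-1}\neq0$, and normalized extremal if moreover $a_{m-1}=1$; such a form is unique when it exists. For a bound $N$, $\mathbb{Z}[\frac1p : p<N]$ denotes the subring of $\mathbb{Q}$ generated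 by $\mathbb{Z}$ and the inverses of all primes $p<N$. *)

theory Defs
  imports
    "HOL-Complex_Analysis.Complex_Analysis"
    "HOL-Library.Function_Algebras"
    "HOL-Computational_Algebra.Primes"
begin

text \<open>
  Functions on the upper half-plane are represented by total functions that vanish elsewhere,
  so that equality of functions and linear (in)dependence have their usual meaning. Sums and
  products of functions are the pointwise ones of \<^theory>\<open>HOL-Library.Function_Algebras\<close>.
\<close>

global_interpretation cfun: vector_space "\<lambda>(c::complex) (f::complex \<Rightarrow> complex) z. c * f z"
  by unfold_locales (auto simp: fun_eq_iff algebra_simps)

definition upper_half_plane :: "complex set" where
  "upper_half_plane = {z. Im z > 0}"

definition nome :: "complex \<Rightarrow> complex" where
  "nome z = exp (2 * of_real pi * \<i> * z)"

definition has_fourier_expansion :: "(complex \<Rightarrow> complex) \<Rightarrow> (nat \<Rightarrow> complex) \<Rightarrow> bool" where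
  "has_fourier_expansion f a \<longleftrightarrow> (\<forall>z\<in>upper_half_plane. (\<lambda>n. a n * nome z ^ n) sums f z)"

definition fourier_coeff :: "(complex \<Rightarrow> complex) \<Rightarrow> nat \<Rightarrow> complex" where
  "fourier_coeff f = (THE a. has_fourier_expansion f a)"

lemma nome_surj:
  assumes "0 < norm q" "norm q < 1"
  obtains z where "z \<in> upper_half_plane" "nome z = q"
proof
  let ?z = "Ln q / (2 * of_real pi * \<i>)"
  have "q \<noteq> 0" using assms by auto
  have "?z = - (\<i> * Ln q) / of_real (2 * pi)"
    by (simp add: field_simps)
  then have "Im ?z = - Re (Ln q) / (2 * pi)"
    by (simp only: Im_divide_of_real) simp
  then show "?z \<in> upper_half_plane"
    using assms \<open>q \<noteq> 0\<close> by (simp add: upper_half_plane_def divide_neg_pos)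
  show "nome ?z = q"
    using \<open>q \<noteq> 0\<close> by (simp add: nome_def)
qed

lemma has_fourier_expansion_unique:
  assumes "has_fourier_expansion f a" "has_fourier_expansion f b"
  shows "a = b"
proof -
  define c where "c n = a n - b n" for n
  have c0: "(\<lambda>n. c n * q ^ n) sums 0" if "0 < norm q" "norm q < 1" for q
  proof -
    from nome_surj[OF that] obtain z where z: "z \<in> upper_half_plane" "nome z = q" .
    then have "(\<lambda>n. a n * q ^ n - b n * q ^ n) sums (f z - f z)"
      using assms unfolding has_fourier_expansion_def by (intro sums_diff) auto
    then show ?thesis by (simp add: c_def algebra_simps)
  qed
  have "((\<lambda>_::complex. 0::complex) \<longlongrightarrow> c 0) (at 0)"
    by (rule powser_limit_0_strong[of 1]) (use c0 in auto)
  then have c00: "c 0 = 0"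
    by (simp add: tendsto_const_iff)
  have cs: "(\<lambda>n. c n * (q - 0) ^ n) sums 0" if "norm (q - 0) < 1" for q
    using c0[of q] that c00 by (cases "q = 0") auto
  have "c n = 0" for n
  proof (rule ccontr)
    assume n: "c n \<noteq> 0"
    then have "n > 0" using c00 by (cases n) auto
    obtain s where s: "0 < s" "\<And>z. z \<in> cball (0::complex) s - {0} \<Longrightarrow> (0::complex) \<noteq> 0"
      by (rule powser_0_nonzero[of 1 0 c "\<lambda>_. 0" n]) (use cs n \<open>n > 0\<close> in auto)
    from s(2)[of "of_real s"] s(1) show False by simp
  qed
  then show ?thesis by (auto simp: c_def fun_eq_iff)
qed

lemma fourier_coeff_eqI: "has_fourier_expansion f a \<Longrightarrow> fourier_coeff f = a"
  unfolding fourier_coeff_def by (rule the_equality) (auto intro: has_fourier_expansion_unique)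

definition divisor_sum :: "nat \<Rightarrow> nat \<Rightarrow> nat" where
  "divisor_sum j n = (\<Sum>d | d dvd n. d ^ j)"

definition eisenstein_E2 :: "complex \<Rightarrow> complex" where
  "eisenstein_E2 z =
     (if z \<in> upper_half_plane
      then 1 - 24 * (\<Sum>n. of_nat (divisor_sum 1 (Suc n)) * nome z ^ Suc n) else 0)"

text \<open>Holomorphy at the cusp is existence of a Fourier expansion without negative powers of \<open>q\<close>.\<close>

definition modular_forms :: "int \<Rightarrow> (complex \<Rightarrow> complex) set" where
  "modular_forms w = {f.
     (\<forall>z. z \<notin> upper_half_plane \<longrightarrow> f z = 0) \<and>
     f holomorphic_on upper_half_plane \<and>
     (\<forall>a b c d :: int. a * d - b * c = 1 \<longrightarrow>
        (\<forall>z\<in>upper_half_plane.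
           f ((of_int a * z + of_int b) / (of_int c * z + of_int d)) =
             (of_int c * z + of_int d) powi w * f z)) \<and>
     (\<exists>a. has_fourier_expansion f a)}"

definition quasimodular_forms_1 :: "int \<Rightarrow> (complex \<Rightarrow> complex) set" where
  "quasimodular_forms_1 w =
     {f0 + f1 * eisenstein_E2 | f0 f1. f0 \<in> modular_forms w \<and> f1 \<in> modular_forms (w - 2)}"

definition depth_exactly_1 :: "int \<Rightarrow> (complex \<Rightarrow> complex) \<Rightarrow> bool" where
  "depth_exactly_1 w f \<longleftrightarrow>
     (\<exists>f0\<in>modular_forms w. \<exists>f1\<in>modular_forms (w - 2). f1 \<noteq> 0 \<and> f = f0 + f1 * eisenstein_E2)"

definition extremal_1 :: "int \<Rightarrow> (complex \<Rightarrow> complex) \<Rightarrow> bool" where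
  "extremal_1 w f \<longleftrightarrow> depth_exactly_1 w f \<and>
     (let m = cfun.dim (quasimodular_forms_1 w) in
        (\<forall>n. n + 1 < m \<longrightarrow> fourier_coeff f n = 0) \<and> fourier_coeff f (m - 1) \<noteq> 0)"

definition normalized_extremal_1 :: "int \<Rightarrow> (complex \<Rightarrow> complex) \<Rightarrow> bool" where
  "normalized_extremal_1 w f \<longleftrightarrow> extremal_1 w f \<and>
     fourier_coeff f (cfun.dim (quasimodular_forms_1 w) - 1) = 1"

inductive_set subring_generated :: "'a::ring_1 set \<Rightarrow> 'a set" for S where
  base: "x \<in> S \<Longrightarrow> x \<in> subring_generated S"
| one: "1 \<in> subring_generated S"
| diff: "x \<in> subring_generated S \<Longrightarrow> y \<in> subring_generated S \<Longrightarrow> x - y \<in> subring_generated S"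
| mult: "x \<in> subring_generated S \<Longrightarrow> y \<in> subring_generated S \<Longrightarrow> x * y \<in> subring_generated S"

definition Z_inverse_primes_below :: "nat \<Rightarrow> rat set" where
  "Z_inverse_primes_below N =
     subring_generated (\<int> \<union> {1 / of_nat p | p :: nat. prime p \<and> p < N})"

end

theory Submission
  imports Defs
begin

text \<open>
  The normalized extremal form of weight \<open>6k + 4\<close> is \<open>E\<^sub>4 F\<^sub>k\<close>, where \<open>F\<^sub>k\<close> is the one of weight
  \<open>w = 6k\<close>. Starting from \<open>F\<^sub>0 = 1\<close>, these are given by
  \<open>F\<^bsub>k+1\<^esub> = (w + 6) / (72 (w + 1) (w + 5)) (E\<^sub>4 \<partial>F\<^sub>k - (w + 1) / 12 E\<^sub>6 F\<^sub>k)\<close>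
  with \<open>\<partial>F = q dF/dq - (w - 1) / 12 E\<^sub>2 F\<close>: the Kaneko-Zagier equation
  \<open>\<partial>\<partial>F\<^sub>k = (w\<^sup>2 - 1) / 144 E\<^sub>4 F\<^sub>k\<close> propagates along the recursion and yields the leading
  coefficient. Only primes dividing some \<open>6 (6j + 1) (6j + 5)\<close> with \<open>j < k\<close> enter the denominators.

  Uniqueness, and with it the dimension, follows from a Wronskian: for \<open>f = f\<^sub>0 + f\<^sub>1 E\<^sub>2\<close> of
  weight \<open>w\<close>, \<open>f\<^sup>2 + 12 (f Df\<^sub>1 - f\<^sub>1 Df)\<close> is a modular form of weight \<open>2w\<close> which vanishes at the
  cusp to at least the order of \<open>f\<close>, so it vanishes identically if that order exceeds \<open>w / 6\<close>; comparing
  lowest coefficients then gives \<open>f = 0\<close>.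

  The only analytic inputs are the transformation law of \<open>E\<^sub>2\<close>, obtained by Eisenstein's comparison of
  the two orders of summation, and the vanishing of modular forms of negative weight. \<open>E\<^sub>4\<close>, \<open>E\<^sub>6\<close> and
  the discriminant are built from \<open>E\<^sub>2\<close> by differentiation and integration, so their divisor sum
  expansions are never needed.
\<close>

section \<open>Partial fractions and sums over the integers\<close>

text \<open>Differentiate both sides of the reflection formula
  \<open>rGamma x * rGamma (1 - x) = sin (pi * x) / pi\<close> and divide by it.\<close>

lemma Digamma_reflection:
  fixes x :: complex
  assumes "x \<notin> \<int>"
  shows "Digamma (1 - x) - Digamma x = of_real pi * cot (of_real pi * x)"
proof -
  have x1: "x \<notin> \<int>\<^sub>\<le>\<^sub>0" using assms by (auto dest: nonpos_Ints_Int)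
  have "1 - x \<notin> \<int>"
    using assms by (metis Ints_1 Ints_diff diff_diff_eq2 add_diff_cancel_left')
  then have x2: "1 - x \<notin> \<int>\<^sub>\<le>\<^sub>0" by (auto dest: nonpos_Ints_Int)
  have "((\<lambda>x. rGamma x * rGamma (1 - x)) has_field_derivative
          (rGamma x * rGamma (1 - x)) * (Digamma (1 - x) - Digamma x)) (at x)"
    using x1 x2 by (auto intro!: derivative_eq_intros simp: algebra_simps)
  moreover have "((\<lambda>x. sin (of_real pi * x) / of_real pi) has_field_derivative
          cos (of_real pi * x)) (at x)"
    by (auto intro!: derivative_eq_intros)
  ultimately have "sin (of_real pi * x) / of_real pi * (Digamma (1 - x) - Digamma x)
                     = cos (of_real pi * x)"
    unfolding rGamma_reflection_complex by (rule DERIV_unique)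
  moreover have "sin (of_real pi * x) \<noteq> 0"
    using assms by (auto simp: sin_eq_0 mult.commute)
  ultimately show ?thesis by (auto simp: cot_def field_simps)
qed

text \<open>One more differentiation of \<open>Digamma_reflection\<close>, possible because that
  identity holds on the open complement of the integers.\<close>

lemma Polygamma_1_reflection:
  fixes x :: complex
  assumes "x \<notin> \<int>"
  shows "Polygamma 1 x + Polygamma 1 (1 - x) = (of_real pi / sin (of_real pi * x))\<^sup>2"
proof -
  have x1: "x \<notin> \<int>\<^sub>\<le>\<^sub>0" using assms by (auto dest: nonpos_Ints_Int)
  have "1 - x \<notin> \<int>"
    using assms by (metis Ints_1 Ints_diff diff_diff_eq2 add_diff_cancel_left')
  then have x2: "1 - x \<notin> \<int>\<^sub>\<le>\<^sub>0" by (auto dest: nonpos_Ints_Int)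
  have nz: "sin (of_real pi * x) \<noteq> 0"
    using assms by (auto simp: sin_eq_0 mult.commute)
  have d1: "((\<lambda>x. Digamma (1 - x) - Digamma x) has_field_derivative
          - (Polygamma 1 (1 - x) + Polygamma 1 x)) (at x)"
    using x1 x2 by (auto intro!: derivative_eq_intros simp: algebra_simps)
  have "((\<lambda>x. of_real pi * cot (of_real pi * x)) has_field_derivative
          of_real pi * (- inverse ((sin (of_real pi * x))\<^sup>2) * of_real pi)) (at x)"
    by (rule DERIV_cmult DERIV_chain2[where g = "\<lambda>x. of_real pi * x"] DERIV_cot[OF nz])+
       (auto intro!: derivative_eq_intros)
  then have d2: "((\<lambda>x. Digamma (1 - x) - Digamma x) has_field_derivative
          of_real pi * (- inverse ((sin (of_real pi * x))\<^sup>2) * of_real pi)) (at x)"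
  proof (rule has_field_derivative_transform_within_open[where S = "- \<int>"])
    show "open (- \<int> :: complex set)" by (intro open_Compl closed_Ints)
  qed (use assms in \<open>auto simp: Digamma_reflection\<close>)
  show ?thesis
    using DERIV_unique[OF d1 d2] by (simp add: power2_eq_square field_simps)
qed

text \<open>The interval is half-open so that it splits into the points \<open>n\<close> and
  \<open>- 1 - n\<close> with \<open>M\<close> terms each. At the latter, \<open>x + k\<close>
  becomes \<open>- (1 - x + n)\<close>, so the two halves match the series of \<open>Digamma\<close>
  and \<open>Polygamma 1\<close> at \<open>x\<close> and at \<open>1 - x\<close>.\<close>

lemma sum_int_symmetric_split:
  fixes f :: "int \<Rightarrow> 'a::comm_monoid_add"
  shows "(\<Sum>n\<in>{- int M..<int M}. f n) = (\<Sum>n<M. f (int n)) + (\<Sum>n<M. f (- 1 - int n))"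
proof (induction M)
  case (Suc M)
  have "{- int (Suc M)..<int (Suc M)} = insert (int M) (insert (- 1 - int M) {- int M..<int M})"
    by auto
  then show ?case using Suc by (simp add: add_ac)
qed auto

text \<open>The one-sided sums diverge, but in the difference of the two \<open>Digamma\<close>
  limits the logarithms cancel.\<close>

lemma LIMSEQ_symmetric_cot:
  fixes x :: complex
  assumes "x \<notin> \<int>"
  shows "(\<lambda>M. \<Sum>k\<in>{- int M..<int M}. inverse (x + of_int k))
           \<longlonglongrightarrow> of_real pi * cot (of_real pi * x)"
proof -
  have "x \<noteq> 0" "1 - x \<noteq> 0" using assms by auto
  from tendsto_diff[OF Digamma_LIMSEQ[OF this(2)] Digamma_LIMSEQ[OF this(1)]]
  have "(\<lambda>M. (\<Sum>n<M. inverse (x + of_nat n)) - (\<Sum>n<M. inverse (1 - x + of_nat n)))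
          \<longlonglongrightarrow> Digamma (1 - x) - Digamma x"
    by simp
  moreover have "(\<Sum>k\<in>{- int M..<int M}. inverse (x + of_int k)) =
      (\<Sum>n<M. inverse (x + of_nat n)) - (\<Sum>n<M. inverse (1 - x + of_nat n))" for M
  proof -
    have "inverse (x + of_int (- 1 - int n)) = - inverse (1 - x + of_nat n)" for n :: nat
      by (subst inverse_minus_eq [symmetric]) (simp add: algebra_simps)
    then show ?thesis
      unfolding sum_int_symmetric_split by (simp only: sum_negf) simp
  qed
  ultimately show ?thesis by (simp add: Digamma_reflection[OF assms])
qed

lemma int_UNIV_split: "(UNIV :: int set) = range int \<union> range (\<lambda>n. - 1 - int n)"
proof -
  have "n \<in> range int \<union> range (\<lambda>n. - 1 - int n)" for n
  proof (cases "n \<ge> 0")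
    case True
    then show ?thesis by (metis UnI1 nonneg_int_cases rangeI)
  next
    case False
    then have "n = - 1 - int (nat (- 1 - n))" by simp
    then show ?thesis by blast
  qed
  then show ?thesis by blast
qed

lemma has_sum_int:
  fixes f :: "int \<Rightarrow> 'a::{topological_comm_monoid_add,t2_space}"
  assumes "((\<lambda>n. f (int n)) has_sum a) UNIV" "((\<lambda>n. f (- 1 - int n)) has_sum b) UNIV"
  shows "(f has_sum (a + b)) UNIV"
proof -
  have "(f has_sum a) (range int)"
    using assms(1) by (subst has_sum_reindex) (auto simp: o_def)
  moreover have "(f has_sum b) (range (\<lambda>n. - 1 - int n))"
    using assms(2) by (subst has_sum_reindex) (auto simp: o_def inj_on_def)
  ultimately show ?thesis
    unfolding int_UNIV_split by (rule has_sum_Un_disjoint) auto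
qed

lemma summable_on_int:
  fixes f :: "int \<Rightarrow> 'a::{topological_comm_monoid_add,t2_space}"
  assumes "(\<lambda>n. f (int n)) summable_on UNIV" "(\<lambda>n. f (- 1 - int n)) summable_on UNIV"
  shows "f summable_on UNIV"
  using assms has_sum_int unfolding summable_on_def by metis

text \<open>The intervals eventually contain every finite set of integers. This turns unconditional
  sums into limits of partial sums, which can be compared with series known in closed form.\<close>

lemma has_sum_int_symmetric:
  assumes "(f has_sum s) (UNIV :: int set)"
  shows "(\<lambda>N. \<Sum>n\<in>{- int N..<int N}. f n) \<longlonglongrightarrow> s"
proof -
  have "filterlim (\<lambda>N. {- int N..<int N}) (finite_subsets_at_top UNIV) sequentially"
    unfolding filterlim_finite_subsets_at_top
  proof safe
    fix X :: "int set" assume "finite X"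
    then obtain B where B: "\<And>x. x \<in> X \<Longrightarrow> \<bar>x\<bar> \<le> B"
      using finite_imageI[of X abs] by (metis bdd_above_finite bdd_above.E imageI)
    have "eventually (\<lambda>N. int N > B) sequentially"
      using eventually_gt_at_top[of "nat B"] by eventually_elim auto
    then show "\<forall>\<^sub>F N in sequentially. finite {- int N..<int N} \<and> X \<subseteq> {- int N..<int N} \<and>
                 {- int N..<int N} \<subseteq> UNIV"
      by eventually_elim (use B in force)
  qed
  with assms show ?thesis
    unfolding has_sum_def by (rule filterlim_compose)
qed

lemma sum_int_telescope:
  fixes g :: "int \<Rightarrow> 'a::ab_group_add"
  shows "(\<Sum>n\<in>{- int N..<int N}. g n - g (n + 1)) = g (- int N) - g (int N)"
proof (induction N)
  case (Suc N)
  have "{- int (Suc N)..<int (Suc N)} = insert (int N) (insert (- 1 - int N) {- int N..<int N})"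
    by auto
  then show ?case using Suc by (simp add: algebra_simps)
qed auto

lemma summable_on_int_powr:
  assumes "s > 1"
  shows "(\<lambda>n::int. (1 + \<bar>real_of_int n\<bar>) powr - s) summable_on UNIV"
proof (rule summable_on_int)
  have "summable (\<lambda>n. real n powr - s)"
    using assms by (simp add: summable_real_powr_iff)
  then have 1: "summable (\<lambda>n. real (Suc n) powr - s)"
    by (subst summable_Suc_iff)
  then show "(\<lambda>n. (1 + \<bar>real_of_int (int n)\<bar>) powr - s) summable_on UNIV"
    by (intro summable_nonneg_imp_summable_on) (auto simp: add_ac)
  have "summable (\<lambda>n. real (Suc (Suc n)) powr - s)"
    using 1 by (subst summable_Suc_iff)
  then show "(\<lambda>n. (1 + \<bar>real_of_int (- 1 - int n)\<bar>) powr - s) summable_on UNIV"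
    by (intro summable_nonneg_imp_summable_on) (auto simp: add_ac)
qed

lemma summable_on_int_square:
  assumes "c \<ge> 0"
  shows "(\<lambda>n::int. C / (1 + \<bar>real_of_int n\<bar> + c)\<^sup>2) summable_on UNIV"
proof -
  have "(\<lambda>n::int. \<bar>C\<bar> * (1 + \<bar>real_of_int n\<bar>) powr - 2) summable_on UNIV"
    by (intro summable_on_cmult_right summable_on_int_powr) auto
  then have "(\<lambda>n::int. norm (C / (1 + \<bar>real_of_int n\<bar> + c)\<^sup>2)) summable_on UNIV"
  proof (rule Infinite_Sum.abs_summable_on_comparison_test')
    fix n :: int
    have "norm (C / (1 + \<bar>real_of_int n\<bar> + c)\<^sup>2) \<le> \<bar>C\<bar> / (1 + \<bar>real_of_int n\<bar>)\<^sup>2"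
      using assms by (auto simp: abs_div intro!: divide_left_mono power_mono mult_pos_pos)
    then show "norm (C / (1 + \<bar>real_of_int n\<bar> + c)\<^sup>2) \<le> \<bar>C\<bar> * (1 + \<bar>real_of_int n\<bar>) powr - 2"
      by (simp add: powr_minus divide_inverse)
  qed
  then show ?thesis by (rule Infinite_Sum.abs_summable_summable)
qed

text \<open>For \<open>r = s + t - 1\<close>, which is at least \<open>s\<close> and at least
  \<open>t\<close>, one has \<open>r^3 >= s^(3/2) t^(3/2)\<close>, so the terms are dominated by a
  product of two summable series in one variable.\<close>

lemma summable_on_int_pair_cube:
  "(\<lambda>(m::int, n::int). C / (1 + \<bar>real_of_int m\<bar> + \<bar>real_of_int n\<bar>) ^ 3) summable_on UNIV"
proof -
  let ?h = "\<lambda>n::int. (1 + \<bar>real_of_int n\<bar>) powr (- (3/2))"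
  have h: "?h summable_on UNIV" by (rule summable_on_int_powr) auto
  have "(\<lambda>(m, n). ?h m * ?h n) summable_on (UNIV \<times> UNIV)"
  proof (rule summable_on_SigmaI)
    show "((\<lambda>n. case (m, n) of (m, n) \<Rightarrow> ?h m * ?h n) has_sum (?h m * infsum ?h UNIV)) UNIV" for m
      using h by (auto intro!: has_sum_cmult_right)
    show "(\<lambda>m. ?h m * infsum ?h UNIV) summable_on UNIV"
      using h by (intro summable_on_cmult_left)
  qed auto
  then have "(\<lambda>x. \<bar>C\<bar> * (case x of (m, n) \<Rightarrow> ?h m * ?h n)) summable_on UNIV"
    by (intro summable_on_cmult_right) simp
  then have "(\<lambda>x. norm (case x of (m::int, n::int) \<Rightarrow>
       C / (1 + \<bar>real_of_int m\<bar> + \<bar>real_of_int n\<bar>) ^ 3)) summable_on UNIV"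
  proof (rule Infinite_Sum.abs_summable_on_comparison_test', safe)
    fix m n :: int
    define s t where "s = 1 + \<bar>real_of_int m\<bar>" and "t = 1 + \<bar>real_of_int n\<bar>"
    have st: "s \<ge> 1" "t \<ge> 1" by (auto simp: s_def t_def)
    define r where "r = s + t - 1"
    have r: "r \<ge> 1" "r \<ge> s" "r \<ge> t" using st by (auto simp: r_def)
    have "r ^ 3 = r powr (3/2) * r powr (3/2)"
      using r by (simp flip: powr_add powr_numeral)
    moreover have "s powr (3/2) * t powr (3/2) \<le> r powr (3/2) * r powr (3/2)"
      using st r by (intro mult_mono powr_mono2) auto
    ultimately have "\<bar>C\<bar> / r ^ 3 \<le> \<bar>C\<bar> / (s powr (3/2) * t powr (3/2))"
      using st r by (intro divide_left_mono mult_pos_pos) auto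
    also have "\<dots> = \<bar>C\<bar> * (s powr - (3/2) * t powr - (3/2))"
      by (simp add: powr_minus field_simps)
    finally show "norm (C / (1 + \<bar>real_of_int m\<bar> + \<bar>real_of_int n\<bar>) ^ 3) \<le> \<bar>C\<bar> * (?h m * ?h n)"
      using r by (simp add: r_def s_def t_def algebra_simps)
  qed
  then show ?thesis by (rule Infinite_Sum.abs_summable_summable)
qed

section \<open>The conditionally convergent lattice sum of weight 2\<close>

text \<open>The imaginary part of \<open>m z + n\<close> controls \<open>m\<close>, and then
  \<open>n = (m z + n) - m z\<close> is controlled as well. The factor 2 pays for the 1 in the
  denominator, since \<open>|m| + |n| >= 1\<close> off the origin.\<close>

lemma norm_inverse_lattice_bound:
  assumes "Im z > 0"
  obtains K where "K > 0" "\<And>m n :: int.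
    norm (inverse (of_int m * z + of_int n)) \<le> K / (1 + \<bar>real_of_int m\<bar> + \<bar>real_of_int n\<bar>)"
proof
  define L where "L = 1 / Im z + 1 + norm z / Im z"
  have L: "L > 0" using assms by (auto simp: L_def intro!: add_pos_nonneg)
  then show "2 * L > 0" by simp
  fix m n :: int
  define u where "u = of_int m * z + of_int n"
  have "\<bar>real_of_int m\<bar> * Im z = \<bar>Im u\<bar>"
    using assms by (simp add: u_def abs_mult)
  also have "\<dots> \<le> norm u" by (rule abs_Im_le_cmod)
  finally have m: "\<bar>real_of_int m\<bar> \<le> norm u / Im z"
    using assms by (simp add: field_simps)
  have "\<bar>real_of_int n\<bar> = norm (u - of_int m * z)" by (simp add: u_def)
  also have "\<dots> \<le> norm u + \<bar>real_of_int m\<bar> * norm z"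
    using norm_triangle_ineq4[of u "of_int m * z"] by (simp add: norm_mult)
  also have "\<dots> \<le> norm u + norm u / Im z * norm z"
    using m by (intro add_left_mono mult_right_mono) auto
  finally have mn: "\<bar>real_of_int m\<bar> + \<bar>real_of_int n\<bar> \<le> L * norm u"
    using m by (simp add: L_def algebra_simps)
  show "norm (inverse u) \<le> 2 * L / (1 + \<bar>real_of_int m\<bar> + \<bar>real_of_int n\<bar>)"
  proof (cases "m = 0 \<and> n = 0")
    case True
    then show ?thesis using L by (simp add: u_def)
  next
    case False
    then have "1 \<le> \<bar>real_of_int m\<bar> + \<bar>real_of_int n\<bar>" by linarith
    with mn have *: "1 + \<bar>real_of_int m\<bar> + \<bar>real_of_int n\<bar> \<le> 2 * L * norm u" by linarith
    have "0 < L * norm u" using * by linarith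
    then have "norm u > 0" using L by (simp add: zero_less_mult_iff)
    have "norm (inverse u) = 1 / norm u" by (simp add: norm_divide inverse_eq_divide)
    also have "\<dots> \<le> 2 * L / (1 + \<bar>real_of_int m\<bar> + \<bar>real_of_int n\<bar>)"
      using * \<open>norm u > 0\<close> by (subst frac_le_eq) (auto simp: divide_simps)
    finally show ?thesis .
  qed
qed

text \<open>
  The lattice point \<open>(0, 0)\<close> needs no special treatment below since \<open>inverse 0 = 0\<close>; this junk
  value even makes the telescoping sum over \<open>n\<close> vanish for \<open>m = 0\<close>.
\<close>

definition lattice_inv :: "complex \<Rightarrow> int \<Rightarrow> int \<Rightarrow> complex" where
  "lattice_inv z m n = inverse (of_int m * z + of_int n)"

definition lattice_step :: "complex \<Rightarrow> int \<Rightarrow> int \<Rightarrow> complex" where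
  "lattice_step z m n = lattice_inv z m n - lattice_inv z m (n + 1)"

text \<open>For \<open>u = m z + n\<close> other than 0 and -1, \<open>lattice_step\<close> is
  \<open>1 / (u (u + 1))\<close>, and subtracting it from \<open>1 / u^2\<close> leaves
  \<open>1 / (u^2 (u + 1))\<close>. This gains one order of decay, enough for absolute convergence
  over the lattice.\<close>

lemma lattice_bounds:
  assumes "Im z > 0"
  obtains C where "\<And>m n. norm (lattice_inv z m n) \<le> C / (1 + \<bar>real_of_int m\<bar> + \<bar>real_of_int n\<bar>)"
    "\<And>m n. norm ((lattice_inv z m n)\<^sup>2) \<le> C / (1 + \<bar>real_of_int m\<bar> + \<bar>real_of_int n\<bar>)\<^sup>2"
    "\<And>m n. norm (lattice_step z m n) \<le> C / (1 + \<bar>real_of_int m\<bar> + \<bar>real_of_int n\<bar>)\<^sup>2"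
    "\<And>m n. norm ((lattice_inv z m n)\<^sup>2 - lattice_step z m n)
            \<le> C / (1 + \<bar>real_of_int m\<bar> + \<bar>real_of_int n\<bar>) ^ 3"
proof -
  from norm_inverse_lattice_bound[OF assms] obtain K where K: "K > 0"
    "\<And>m n. norm (lattice_inv z m n) \<le> K / (1 + \<bar>real_of_int m\<bar> + \<bar>real_of_int n\<bar>)"
    unfolding lattice_inv_def by blast
  \<comment> \<open>The constants 4 and 16 cover the points \<open>(0, 0)\<close> and
    \<open>(0, -1)\<close>, where one of the inverses is 0 by convention. At \<open>(0, -1)\<close>
    one has \<open>r = 2\<close>, the step has norm 1 and the difference has norm 2.\<close>
  define C where "C = max (max K (K\<^sup>2)) (max (2 * K\<^sup>2 + 4) (2 * K ^ 3 + 16))"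
  have C: "K \<le> C" "K\<^sup>2 \<le> C" "2 * K\<^sup>2 \<le> C" "4 \<le> C" "2 * K ^ 3 \<le> C" "16 \<le> C"
    using K(1) by (auto simp: C_def le_max_iff_disj)
  have gen: "norm (lattice_inv z m n) \<le> C / r" "norm ((lattice_inv z m n)\<^sup>2) \<le> C / r\<^sup>2"
    "norm (lattice_step z m n) \<le> C / r\<^sup>2"
    "norm ((lattice_inv z m n)\<^sup>2 - lattice_step z m n) \<le> C / r ^ 3"
    if r: "r = 1 + \<bar>real_of_int m\<bar> + \<bar>real_of_int n\<bar>" for m n r
  proof -
    define u where "u = of_int m * z + of_int n"
    have r1: "r \<ge> 1" by (simp add: r)
    have g: "norm (inverse u) \<le> K / r"
      using K(2)[of m n] by (simp add: lattice_inv_def r u_def)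
    have "norm (inverse (u + 1)) \<le> K / (1 + \<bar>real_of_int m\<bar> + \<bar>real_of_int (n + 1)\<bar>)"
      using K(2)[of m "n + 1"] by (simp add: lattice_inv_def u_def add_ac)
    also have "\<dots> \<le> K / (r / 2)"
      using K(1) r1 unfolding r by (intro divide_left_mono mult_pos_pos) (auto simp: abs_if)
    finally have g': "norm (inverse (u + 1)) \<le> 2 * K / r" by (simp add: mult.commute)
    show "norm (lattice_inv z m n) \<le> C / r"
      using order_trans[OF g divide_right_mono[OF C(1), of r]] r1
      by (simp add: lattice_inv_def u_def)
    have "norm ((inverse u)\<^sup>2) \<le> (K / r)\<^sup>2"
      unfolding norm_power by (intro power_mono g) auto
    also have "\<dots> \<le> C / r\<^sup>2" using C by (auto simp: power_divide intro!: divide_right_mono)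
    finally show "norm ((lattice_inv z m n)\<^sup>2) \<le> C / r\<^sup>2" by (simp add: lattice_inv_def u_def)
    have step: "lattice_step z m n = inverse u - inverse (u + 1)"
      by (simp add: lattice_step_def lattice_inv_def u_def add_ac)
    have exc: "m = 0 \<and> (n = 0 \<or> n = -1)" if "u = 0 \<or> u + 1 = 0"
    proof -
      have "Im u = 0" using that by (auto simp: complex_eq_iff)
      then have "m = 0" using assms by (simp add: u_def)
      with that have "of_int n = (0 :: complex) \<or> of_int (n + 1) = (0 :: complex)"
        by (simp add: u_def)
      then have "n = 0 \<or> n + 1 = 0" by (simp only: of_int_eq_0_iff)
      with \<open>m = 0\<close> show ?thesis by auto
    qed
    show "norm (lattice_step z m n) \<le> C / r\<^sup>2"
    proof (cases "u = 0 \<or> u + 1 = 0")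
      case True
      with exc have "m = 0 \<and> (n = 0 \<or> n = -1)" by blast
      then show ?thesis using C by (auto simp: lattice_step_def lattice_inv_def r field_simps)
    next
      case False
      then have "lattice_step z m n = inverse u * inverse (u + 1)"
        by (simp add: step field_simps)
      also have "norm \<dots> \<le> K / r * (2 * K / r)"
        unfolding norm_mult using K(1) r1 by (intro mult_mono g g') auto
      also have "\<dots> \<le> C / r\<^sup>2"
        using C by (auto simp: power2_eq_square intro!: divide_right_mono)
      finally show ?thesis .
    qed
    show "norm ((lattice_inv z m n)\<^sup>2 - lattice_step z m n) \<le> C / r ^ 3"
    proof (cases "u = 0 \<or> u + 1 = 0")
      case True
      with exc have "m = 0 \<and> (n = 0 \<or> n = -1)" by blast
      then show ?thesis using C by (auto simp: lattice_step_def lattice_inv_def r field_simps)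
    next
      case False
      have "(lattice_inv z m n)\<^sup>2 - lattice_step z m n = (inverse u)\<^sup>2 * inverse (u + 1)"
        unfolding step lattice_inv_def u_def[symmetric]
        using False by (simp add: divide_simps power2_eq_square)
      also have "norm \<dots> \<le> (K / r)\<^sup>2 * (2 * K / r)"
        unfolding norm_mult norm_power using K(1) r1
        by (intro mult_mono power_mono g g') auto
      also have "\<dots> \<le> C / r ^ 3"
        using C r1 by (auto simp: power2_eq_square power3_eq_cube intro!: divide_right_mono)
      finally show ?thesis .
    qed
  qed
  show ?thesis by (rule that; rule gen; simp)
qed

lemma summable_on_lattice_inv_square:
  assumes "Im z > 0"
  shows "(\<lambda>n. (lattice_inv z m n)\<^sup>2) summable_on UNIV" "(\<lambda>m. (lattice_inv z m n)\<^sup>2) summable_on UNIV"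
    "(\<lambda>n. lattice_step z m n) summable_on UNIV" "(\<lambda>m. lattice_step z m n) summable_on UNIV"
    "(\<lambda>(m, n). (lattice_inv z m n)\<^sup>2 - lattice_step z m n) summable_on UNIV"
proof -
  from lattice_bounds[OF assms] obtain C where C:
    "\<And>m n. norm ((lattice_inv z m n)\<^sup>2) \<le> C / (1 + \<bar>real_of_int m\<bar> + \<bar>real_of_int n\<bar>)\<^sup>2"
    "\<And>m n. norm (lattice_step z m n) \<le> C / (1 + \<bar>real_of_int m\<bar> + \<bar>real_of_int n\<bar>)\<^sup>2"
    "\<And>m n. norm ((lattice_inv z m n)\<^sup>2 - lattice_step z m n)
            \<le> C / (1 + \<bar>real_of_int m\<bar> + \<bar>real_of_int n\<bar>) ^ 3"
    by metis
  have 1: "(\<lambda>n. C / (1 + \<bar>real_of_int m\<bar> + \<bar>real_of_int n\<bar>)\<^sup>2) summable_on UNIV" for m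
    using summable_on_int_square[of "\<bar>real_of_int m\<bar>" C] by (simp add: algebra_simps)
  have 2: "(\<lambda>m. C / (1 + \<bar>real_of_int m\<bar> + \<bar>real_of_int n\<bar>)\<^sup>2) summable_on UNIV" for n
    using summable_on_int_square[of "\<bar>real_of_int n\<bar>" C] by simp
  note t = Infinite_Sum.abs_summable_summable[OF Infinite_Sum.abs_summable_on_comparison_test']
  show "(\<lambda>n. (lattice_inv z m n)\<^sup>2) summable_on UNIV" by (rule t[OF 1 C(1)])
  show "(\<lambda>m. (lattice_inv z m n)\<^sup>2) summable_on UNIV" by (rule t[OF 2 C(1)])
  show "(\<lambda>n. lattice_step z m n) summable_on UNIV" by (rule t[OF 1 C(2)])
  show "(\<lambda>m. lattice_step z m n) summable_on UNIV" by (rule t[OF 2 C(2)])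
  show "(\<lambda>(m, n). (lattice_inv z m n)\<^sup>2 - lattice_step z m n) summable_on UNIV"
    by (rule t[OF summable_on_int_pair_cube[of C]]) (use C(3) in auto)
qed

lemma lattice_inv_tendsto_0:
  assumes "Im z > 0"
  shows "(\<lambda>N. lattice_inv z m (int N)) \<longlonglongrightarrow> 0" "(\<lambda>N. lattice_inv z m (- int N)) \<longlonglongrightarrow> 0"
proof -
  from lattice_bounds[OF assms] obtain C where C:
    "\<And>m n. norm (lattice_inv z m n) \<le> C / (1 + \<bar>real_of_int m\<bar> + \<bar>real_of_int n\<bar>)"
    by metis
  have lim: "(\<lambda>N. C / (1 + \<bar>real_of_int m\<bar> + real N)) \<longlonglongrightarrow> 0"
    by (intro real_tendsto_divide_at_top[OF tendsto_const]
          filterlim_tendsto_add_at_top[OF tendsto_const] filterlim_real_sequentially)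
  show "(\<lambda>N. lattice_inv z m (int N)) \<longlonglongrightarrow> 0"
    using C[of m "int N" for N] by (intro Lim_null_comparison[OF _ lim] always_eventually) simp
  have "norm (lattice_inv z m (- int N)) \<le> C / (1 + \<bar>real_of_int m\<bar> + real N)" for N
    using C[of m "- int N"] by simp
  then show "(\<lambda>N. lattice_inv z m (- int N)) \<longlonglongrightarrow> 0"
    by (intro Lim_null_comparison[OF _ lim]) auto
qed

lemma infsum_lattice_step:
  assumes "Im z > 0"
  shows "(\<Sum>\<^sub>\<infinity>n. lattice_step z m n) = 0"
proof -
  have "(\<lambda>N. \<Sum>n\<in>{- int N..<int N}. lattice_step z m n) \<longlonglongrightarrow> (\<Sum>\<^sub>\<infinity>n. lattice_step z m n)"
    by (intro has_sum_int_symmetric has_sum_infsum summable_on_lattice_inv_square assms)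
  moreover have "(\<lambda>N. \<Sum>n\<in>{- int N..<int N}. lattice_step z m n) \<longlonglongrightarrow> 0 - 0"
    unfolding lattice_step_def sum_int_telescope
    by (intro tendsto_diff lattice_inv_tendsto_0 assms)
  ultimately show ?thesis by (simp add: LIMSEQ_unique)
qed

definition lattice_row :: "complex \<Rightarrow> int \<Rightarrow> complex" where
  "lattice_row z m = (\<Sum>\<^sub>\<infinity>n. (lattice_inv z m n)\<^sup>2)"

text \<open>
  Subtracting the telescoping term makes the double series absolutely convergent. Since that term sums
  to 0 along every row, this is the Eisenstein sum of the rows; its sum along the columns does not
  vanish and produces the correction term in the transformation law.
\<close>

definition lattice_sum2 :: "complex \<Rightarrow> complex" where
  "lattice_sum2 z = (\<Sum>\<^sub>\<infinity>(m, n). (lattice_inv z m n)\<^sup>2 - lattice_step z m n)"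

lemma has_sum_lattice_row:
  assumes "Im z > 0"
  shows "(lattice_row z has_sum lattice_sum2 z) UNIV"
proof (rule has_sum_SigmaD)
  show "((\<lambda>(m, n). (lattice_inv z m n)\<^sup>2 - lattice_step z m n) has_sum lattice_sum2 z) (UNIV \<times> UNIV)"
    using summable_on_lattice_inv_square(5)[OF assms] unfolding lattice_sum2_def by simp
  fix m
  have "((\<lambda>n. (lattice_inv z m n)\<^sup>2 + - lattice_step z m n) has_sum
           (lattice_row z m + - (\<Sum>\<^sub>\<infinity>n. lattice_step z m n))) UNIV"
    unfolding lattice_row_def
    by (intro has_sum_add has_sum_uminusI has_sum_infsum summable_on_lattice_inv_square assms)
  then show "((\<lambda>n. case (m, n) of (m, n) \<Rightarrow> (lattice_inv z m n)\<^sup>2 - lattice_step z m n)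
                has_sum lattice_row z m) UNIV"
    by (simp add: infsum_lattice_step[OF assms])
qed

section \<open>Behaviour of the lattice sum under \<open>z \<mapsto> - 1 / z\<close>\<close>

lemma lattice_inv_S:
  assumes "z \<noteq> 0"
  shows "lattice_inv (- 1 / z) m n = - z * lattice_inv z (- n) m"
proof -
  define v where "v = of_int (- n) * z + of_int m"
  have "of_int m * (- 1 / z) + of_int n = - (v / z)"
    using assms by (simp add: v_def field_simps)
  then show ?thesis
    unfolding lattice_inv_def v_def[symmetric]
    by (simp only: inverse_minus_eq inverse_divide) (simp add: divide_inverse)
qed

text \<open>\<open>S\<close> exchanges the two lattice indices up to sign, so that a column for
  \<open>z\<close> is a row for \<open>- 1 / z\<close>.\<close>

lemma lattice_column_S:
  assumes "z \<noteq> 0"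
  shows "(\<Sum>\<^sub>\<infinity>m. (lattice_inv z m n)\<^sup>2) = lattice_row (- 1 / z) n / z\<^sup>2"
proof -
  have "lattice_row (- 1 / z) n = (\<Sum>\<^sub>\<infinity>m. z\<^sup>2 * (lattice_inv z (- m) n)\<^sup>2)"
    unfolding lattice_row_def lattice_inv_S[OF assms] by (simp add: power_mult_distrib)
  also have "\<dots> = z\<^sup>2 * (\<Sum>\<^sub>\<infinity>m. (lattice_inv z (- m) n)\<^sup>2)"
    by (rule infsum_cmult_right')
  also have "(\<Sum>\<^sub>\<infinity>m. (lattice_inv z (- m) n)\<^sup>2) = (\<Sum>\<^sub>\<infinity>m. (lattice_inv z m n)\<^sup>2)"
    by (rule infsum_reindex_bij_witness[of _ uminus uminus]) auto
  finally show ?thesis using assms by simp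
qed

text \<open>The right side makes the limit for growing \<open>N\<close> visible:
  \<open>nome (- 1 / z)\<close> has norm below 1, so the cotangent tends to
  \<open>\<i>\<close>.\<close>

lemma cot_eq_nome:
  assumes "Im z > 0"
  shows "cot (of_real pi * (of_nat N / z)) =
           \<i> * (1 + nome (- 1 / z) ^ N) / (1 - nome (- 1 / z) ^ N)"
proof -
  define w where "w = of_real pi * (of_nat N / z)"
  have e: "exp (\<i> * w) * exp (\<i> * w) * nome (- 1 / z) ^ N = 1"
    by (simp add: nome_def w_def flip: exp_of_nat_mult exp_add)
  define E where "E = exp (\<i> * w)"
  have E0: "E \<noteq> 0" by (simp add: E_def)
  have nm: "nome (- 1 / z) ^ N = 1 / (E * E)"
    using e E0 unfolding E_def by (simp add: field_simps)
  have "cot w = ((E + 1 / E) / 2) / ((E - 1 / E) / (2 * \<i>))"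
    unfolding cot_def by (simp add: cos_exp_eq sin_exp_eq E_def exp_minus inverse_eq_divide)
  also have "\<dots> = \<i> * (1 + 1 / (E * E)) / (1 - 1 / (E * E))"
    using E0 by (simp add: divide_simps)
  finally show ?thesis unfolding w_def nm .
qed

lemma Im_S_pos: "Im z > 0 \<Longrightarrow> Im (- 1 / z) > 0"
  by (simp add: Im_divide divide_pos_pos sum_power2_gt_zero_iff)

lemma norm_nome_less_1: "Im z > 0 \<Longrightarrow> norm (nome z) < 1"
  by (simp add: nome_def)

lemma nome_nonzero [simp]: "nome z \<noteq> 0"
  by (simp add: nome_def)

lemma has_sum_finite_sum:
  fixes f :: "'a \<Rightarrow> 'b \<Rightarrow> 'c::topological_comm_monoid_add"
  assumes "finite I" "\<And>i. i \<in> I \<Longrightarrow> (f i has_sum s i) A"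
  shows "((\<lambda>x. \<Sum>i\<in>I. f i x) has_sum (\<Sum>i\<in>I. s i)) A"
  using assms by (induction I rule: finite_induct) (auto intro!: has_sum_add)

text \<open>Summing over \<open>n\<close> first telescopes to the boundary terms at
  \<open>- N\<close> and \<open>N\<close>. Their sum over \<open>m\<close> is a difference of two
  partial fraction series, at \<open>- N / z\<close> and \<open>N / z\<close>, each of which is a
  cotangent.\<close>

lemma sum_lattice_step_columns:
  assumes "Im z > 0" "N > 0"
  shows "(\<Sum>n\<in>{- int N..<int N}. \<Sum>\<^sub>\<infinity>m. lattice_step z m n) =
           - (2 * of_real pi / z) * cot (of_real pi * (of_nat N / z))"
proof -
  define x where "x = of_nat N / z"
  have z0: "z \<noteq> 0" using assms by auto
  have "Im x < 0"
    using assms by (auto simp: x_def Im_divide intro!: divide_pos_pos add_nonneg_pos)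
  then have x: "x \<notin> \<int>" "- x \<notin> \<int>" by (auto simp: Ints_def complex_eq_iff)
  define h where "h m = lattice_inv z m (- int N) - lattice_inv z m (int N)" for m
  have "((\<lambda>m. \<Sum>n\<in>{- int N..<int N}. lattice_step z m n) has_sum
          (\<Sum>n\<in>{- int N..<int N}. \<Sum>\<^sub>\<infinity>m. lattice_step z m n)) UNIV"
    by (intro has_sum_finite_sum has_sum_infsum summable_on_lattice_inv_square assms) auto
  then have "(h has_sum (\<Sum>n\<in>{- int N..<int N}. \<Sum>\<^sub>\<infinity>m. lattice_step z m n)) UNIV"
    unfolding lattice_step_def sum_int_telescope by (simp add: h_def [abs_def])
  note has_sum_int_symmetric[OF this]
  moreover have "h m = (inverse (- x + of_int m) - inverse (x + of_int m)) / z" for m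
  proof -
    have eq: "of_int m * z + of_int (- int N) = z * (- x + of_int m)"
         "of_int m * z + of_int (int N) = z * (x + of_int m)"
      using z0 by (simp_all add: x_def field_simps)
    show ?thesis
      unfolding h_def lattice_inv_def eq inverse_mult_distrib
      by (simp add: divide_inverse algebra_simps)
  qed
  then have "(\<Sum>m\<in>{- int M..<int M}. h m) = ((\<Sum>m\<in>{- int M..<int M}. inverse (- x + of_int m)) -
               (\<Sum>m\<in>{- int M..<int M}. inverse (x + of_int m))) / z" for M
    by (simp add: sum_subtractf flip: sum_divide_distrib)
  then have "(\<lambda>M. \<Sum>m\<in>{- int M..<int M}. h m) \<longlonglongrightarrow>
               (of_real pi * cot (of_real pi * - x) - of_real pi * cot (of_real pi * x)) / z"
    by (simp only:) (intro tendsto_intros LIMSEQ_symmetric_cot x z0)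
  ultimately have "(\<Sum>n\<in>{- int N..<int N}. \<Sum>\<^sub>\<infinity>m. lattice_step z m n) =
      (of_real pi * cot (of_real pi * - x) - of_real pi * cot (of_real pi * x)) / z"
    by (rule LIMSEQ_unique)
  also have "\<dots> = - (2 * of_real pi / z) * cot (of_real pi * x)"
    by (simp add: cot_def field_simps)
  finally show ?thesis by (simp add: x_def)
qed

text \<open>Absolute convergence permits summation by columns instead of rows. The squares then give
  the rows for \<open>- 1 / z\<close>, while the telescoping terms no longer cancel but contribute
  the limit of \<open>sum_lattice_step_columns\<close>.\<close>

lemma lattice_sum2_S:
  assumes "Im z > 0"
  shows "lattice_sum2 (- 1 / z) / z\<^sup>2 = lattice_sum2 z - 2 * of_real pi * \<i> / z"
proof -
  have z0: "z \<noteq> 0" using assms by auto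
  let ?B = "\<lambda>n. \<Sum>\<^sub>\<infinity>m. lattice_step z m n"
  have "((\<lambda>n. lattice_row (- 1 / z) n / z\<^sup>2 - ?B n) has_sum lattice_sum2 z) UNIV"
  proof (rule has_sum_SigmaD)
    show "((\<lambda>(n, m). (lattice_inv z m n)\<^sup>2 - lattice_step z m n) has_sum lattice_sum2 z) (UNIV \<times> UNIV)"
      using summable_on_lattice_inv_square(5)[OF assms] unfolding lattice_sum2_def
      by (subst has_sum_swap) (simp add: case_prod_unfold)
    fix n
    have "((\<lambda>m. (lattice_inv z m n)\<^sup>2 + - lattice_step z m n) has_sum
             (lattice_row (- 1 / z) n / z\<^sup>2 + - ?B n)) UNIV"
      unfolding lattice_column_S[OF z0, symmetric]
      by (intro has_sum_add has_sum_uminusI has_sum_infsum summable_on_lattice_inv_square assms)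
    then show "((\<lambda>m. case (n, m) of (n, m) \<Rightarrow> (lattice_inv z m n)\<^sup>2 - lattice_step z m n)
                  has_sum (lattice_row (- 1 / z) n / z\<^sup>2 - ?B n)) UNIV" by simp
  qed
  from has_sum_int_symmetric[OF this]
  have 1: "(\<lambda>N. (\<Sum>n\<in>{- int N..<int N}. lattice_row (- 1 / z) n / z\<^sup>2) - (\<Sum>n\<in>{- int N..<int N}. ?B n))
          \<longlonglongrightarrow> lattice_sum2 z"
    by (simp add: sum_subtractf)
  have "(\<lambda>N. \<Sum>n\<in>{- int N..<int N}. lattice_row (- 1 / z) n / z\<^sup>2)
          \<longlonglongrightarrow> lattice_sum2 (- 1 / z) / z\<^sup>2"
    by (intro has_sum_int_symmetric has_sum_divide_const has_sum_lattice_row Im_S_pos assms)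
  moreover have "(\<lambda>N. \<Sum>n\<in>{- int N..<int N}. ?B n) \<longlonglongrightarrow> - (2 * of_real pi * \<i> / z)"
  proof -
    have "(\<lambda>N. nome (- 1 / z) ^ N) \<longlonglongrightarrow> 0"
      by (intro LIMSEQ_power_zero norm_nome_less_1 Im_S_pos assms)
    then have "(\<lambda>N. - (2 * of_real pi / z) * (\<i> * (1 + nome (- 1 / z) ^ N) / (1 - nome (- 1 / z) ^ N)))
            \<longlonglongrightarrow> - (2 * of_real pi / z) * (\<i> * (1 + 0) / (1 - 0))"
      by (intro tendsto_mult tendsto_divide tendsto_add tendsto_diff tendsto_const) auto
    moreover have "eventually (\<lambda>N. - (2 * of_real pi / z) * (\<i> * (1 + nome (- 1 / z) ^ N) /
        (1 - nome (- 1 / z) ^ N)) = (\<Sum>n\<in>{- int N..<int N}. ?B n)) sequentially"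
      using eventually_gt_at_top[of 0]
      by eventually_elim (simp only: sum_lattice_step_columns[OF assms] cot_eq_nome[OF assms])
    ultimately show ?thesis
      by (simp add: filterlim_cong)
  qed
  ultimately have "(\<lambda>N. (\<Sum>n\<in>{- int N..<int N}. lattice_row (- 1 / z) n / z\<^sup>2) - (\<Sum>n\<in>{- int N..<int N}. ?B n))
          \<longlonglongrightarrow> lattice_sum2 (- 1 / z) / z\<^sup>2 - - (2 * of_real pi * \<i> / z)"
    by (rule tendsto_diff)
  from LIMSEQ_unique[OF 1 this] show ?thesis by simp
qed

section \<open>The transformation law of the weight 2 Eisenstein series\<close>

lemma LIMSEQ_Polygamma_1:
  fixes x :: complex
  assumes "x \<noteq> 0"
  shows "(\<lambda>M. \<Sum>n<M. inverse ((x + of_nat n)\<^sup>2)) \<longlonglongrightarrow> Polygamma 1 x"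
proof -
  have "summable (\<lambda>n. inverse ((x + of_nat n)\<^sup>2))"
    by (rule Polygamma_converges') (use assms in auto)
  then show ?thesis
    by (simp add: Polygamma_def summable_LIMSEQ eval_nat_numeral)
qed

lemma lattice_row_nonzero:
  assumes "Im z > 0" "m \<noteq> 0"
  shows "lattice_row z m = (of_real pi / sin (of_real pi * (of_int m * z)))\<^sup>2"
proof -
  define x where "x = of_int m * z"
  have "Im x \<noteq> 0" using assms by (auto simp: x_def)
  then have x: "x \<notin> \<int>" "x \<noteq> 0" "1 - x \<noteq> 0" by (auto simp: Ints_def complex_eq_iff)
  have "(\<lambda>N. \<Sum>n\<in>{- int N..<int N}. (lattice_inv z m n)\<^sup>2) \<longlonglongrightarrow> lattice_row z m"
    unfolding lattice_row_def
    by (intro has_sum_int_symmetric has_sum_infsum summable_on_lattice_inv_square assms)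
  moreover have "(lattice_inv z m (int n))\<^sup>2 = inverse ((x + of_nat n)\<^sup>2)"
    "(lattice_inv z m (- 1 - int n))\<^sup>2 = inverse ((1 - x + of_nat n)\<^sup>2)" for n
  proof -
    show "(lattice_inv z m (int n))\<^sup>2 = inverse ((x + of_nat n)\<^sup>2)"
      by (simp add: lattice_inv_def x_def power_inverse)
    have "of_int m * z + of_int (- 1 - int n) = - (1 - x + of_nat n)"
      by (simp add: x_def)
    then show "(lattice_inv z m (- 1 - int n))\<^sup>2 = inverse ((1 - x + of_nat n)\<^sup>2)"
      unfolding lattice_inv_def power_inverse by (simp only: power2_minus)
  qed
  moreover have "(\<lambda>N. (\<Sum>n<N. inverse ((x + of_nat n)\<^sup>2)) + (\<Sum>n<N. inverse ((1 - x + of_nat n)\<^sup>2)))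
     \<longlonglongrightarrow> Polygamma 1 x + Polygamma 1 (1 - x)"
    by (intro tendsto_add LIMSEQ_Polygamma_1 x)
  ultimately have "lattice_row z m = Polygamma 1 x + Polygamma 1 (1 - x)"
    unfolding sum_int_symmetric_split by (simp only: LIMSEQ_unique)
  then show ?thesis using Polygamma_1_reflection[OF x(1)] by (simp add: x_def)
qed

lemma lattice_row_0:
  assumes "Im z > 0"
  shows "lattice_row z 0 = of_real (pi\<^sup>2 / 3)"
proof -
  have "(\<lambda>N. \<Sum>n<N. complex_of_real (1 / (real n + 1)\<^sup>2)) \<longlonglongrightarrow> of_real (pi\<^sup>2 / 6)"
    using inverse_squares_sums unfolding sums_def of_real_sum[symmetric]
    by (intro tendsto_of_real) (simp add: add_ac)
  then have s: "(\<lambda>N. \<Sum>n<N. inverse ((1 + of_nat n :: complex)\<^sup>2)) \<longlonglongrightarrow> of_real (pi\<^sup>2 / 6)"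
    by (simp add: inverse_eq_divide add_ac)
  have "(\<lambda>N. \<Sum>n\<in>{- int N..<int N}. (lattice_inv z 0 n)\<^sup>2) \<longlonglongrightarrow> lattice_row z 0"
    unfolding lattice_row_def
    by (intro has_sum_int_symmetric has_sum_infsum summable_on_lattice_inv_square assms)
  \<comment> \<open>The shift makes room for \<open>n = 0\<close>: its term is 0, so the half with
    nonnegative \<open>n\<close> has only \<open>N\<close> nonzero terms and the other half has
    \<open>N + 1\<close>.\<close>
  then have "(\<lambda>N. \<Sum>n\<in>{- int (Suc N)..<int (Suc N)}. (lattice_inv z 0 n)\<^sup>2) \<longlonglongrightarrow> lattice_row z 0"
    by (rule LIMSEQ_Suc)
  moreover have "(\<Sum>n\<in>{- int (Suc N)..<int (Suc N)}. (lattice_inv z 0 n)\<^sup>2) =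
    (\<Sum>n<N. inverse ((1 + of_nat n :: complex)\<^sup>2)) + (\<Sum>n<Suc N. inverse ((1 + of_nat n :: complex)\<^sup>2))" for N
  proof -
    have "(lattice_inv z 0 (- 1 - int n))\<^sup>2 = inverse ((1 + of_nat n)\<^sup>2)" for n
    proof -
      have "of_int 0 * z + of_int (- 1 - int n) = - (1 + of_nat n)" by simp
      then show ?thesis
        unfolding lattice_inv_def power_inverse by (simp only: power2_minus)
    qed
    then show ?thesis
      unfolding sum_int_symmetric_split sum.lessThan_Suc_shift[of "\<lambda>n. (lattice_inv z 0 (int n))\<^sup>2"]
      by (simp add: lattice_inv_def power_inverse)
  qed
  moreover have "(\<lambda>N. (\<Sum>n<N. inverse ((1 + of_nat n :: complex)\<^sup>2)) + (\<Sum>n<Suc N. inverse ((1 + of_nat n :: complex)\<^sup>2)))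
       \<longlonglongrightarrow> of_real (pi\<^sup>2 / 6) + of_real (pi\<^sup>2 / 6)"
    by (intro tendsto_add s LIMSEQ_Suc)
  ultimately have "lattice_row z 0 = of_real (pi\<^sup>2 / 6) + of_real (pi\<^sup>2 / 6)"
    by (simp only: LIMSEQ_unique)
  then show ?thesis by (simp flip: of_real_add)
qed

text \<open>Since \<open>q / (1 - q)^2\<close> is the sum of all \<open>d q^d\<close>, this leads to
  Lipschitz' formula in weight 2. The auxiliary \<open>E\<close> is a square root of
  \<open>nome w\<close>, in which the sine is rational.\<close>

lemma cosecant_square_nome:
  assumes "Im w > 0"
  shows "(of_real pi / sin (of_real pi * w))\<^sup>2 = - 4 * (of_real pi)\<^sup>2 * (nome w / (1 - nome w)\<^sup>2)"
proof -
  define E where "E = exp (\<i> * (of_real pi * w))"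
  have E0: "E \<noteq> 0" by (simp add: E_def)
  have nm: "nome w = E\<^sup>2"
    unfolding E_def nome_def by (simp add: power2_eq_square algebra_simps flip: exp_add)
  have "nome w \<noteq> 1" using norm_nome_less_1[OF assms] by auto
  then have E1: "E\<^sup>2 \<noteq> 1" by (simp add: nm)
  have "sin (of_real pi * w) = (E - 1 / E) / (2 * \<i>)"
    by (simp add: sin_exp_eq E_def exp_minus inverse_eq_divide)
  also have "\<dots> = (E\<^sup>2 - 1) / (2 * \<i> * E)"
    using E0 by (simp add: field_simps power2_eq_square)
  finally have "(of_real pi / sin (of_real pi * w))\<^sup>2 = (2 * \<i> * E * of_real pi / (E\<^sup>2 - 1))\<^sup>2"
    by (simp add: field_simps)
  also have "\<dots> = - 4 * (of_real pi)\<^sup>2 * (E\<^sup>2 / (1 - E\<^sup>2)\<^sup>2)"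
    by (simp add: power_mult_distrib power_divide power2_commute[of 1])
  finally show ?thesis unfolding nm .
qed

lemma nome_of_nat_mult: "nome (of_nat m * z) = nome z ^ m"
  by (simp add: nome_def mult_ac flip: exp_of_nat_mult)

section \<open>Divisor sums and their Lambert series\<close>

lemma divisor_sum_1_le: "divisor_sum 1 n \<le> n\<^sup>2"
proof (cases "n = 0")
  case False
  have "divisor_sum 1 n \<le> (\<Sum>d\<in>{1..n}. n)"
    unfolding divisor_sum_def using False
    by (intro sum_le_included[of _ _ _ "\<lambda>x. x"]) (auto dest: dvd_imp_le dvd_pos_nat intro!: Suc_leI)
  then show ?thesis by (simp add: power2_eq_square)
\<comment> \<open>Every number divides 0, and a sum over an infinite set is 0.\<close>
qed (simp add: divisor_sum_def)

lemma summable_divisor_sum: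
  fixes r :: real
  assumes "0 \<le> r" "r < 1"
  shows "summable (\<lambda>n. of_nat (divisor_sum 1 n) * r ^ n)"
proof -
  \<comment> \<open>The majorant is the second derivative of the geometric series.\<close>
  have "summable (\<lambda>n. diffs (diffs (\<lambda>_. 1)) n * r ^ n)"
    by (rule termdiff_converges[of _ 1], use assms in simp, rule termdiff_converges[of _ 1])
       (auto intro: summable_geometric)
  then have "summable (\<lambda>n. ((1 + real n) * (2 + real n)) * r ^ n)"
    by (simp add: diffs_def add_ac)
  then show ?thesis
  proof (rule summable_comparison_test'[where N = 0])
    fix n :: nat
    have "real (divisor_sum 1 n) \<le> real (n\<^sup>2)"
      using divisor_sum_1_le[of n] by (simp only: of_nat_le_iff)
    also have "\<dots> \<le> (1 + real n) * (2 + real n)" by (simp add: power2_eq_square algebra_simps)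
    finally show "norm (real (divisor_sum 1 n) * r ^ n) \<le> (1 + real n) * (2 + real n) * r ^ n"
      using assms by (simp add: mult_right_mono)
  qed
qed

lemma has_sum_of_nat_power:
  fixes q :: complex
  assumes "norm q < 1"
  shows "((\<lambda>d. of_nat d * q ^ d) has_sum (q / (1 - q)\<^sup>2)) {1..}"
proof -
  have "(\<lambda>d. of_nat (Suc d) * q ^ d) sums (1 / (1 - q)\<^sup>2)"
    by (rule geometric_deriv_sums[OF assms])
  then have 1: "(\<lambda>d. q * (of_nat (Suc d) * q ^ d)) sums (q * (1 / (1 - q)\<^sup>2))"
    by (rule sums_mult)
  have "(\<lambda>d. of_nat (Suc d) * norm q ^ d) sums (1 / (1 - norm q)\<^sup>2)"
    by (rule geometric_deriv_sums) (use assms in auto)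
  then have 2: "summable (\<lambda>d. norm q * (of_nat (Suc d) * norm q ^ d))"
    by (intro summable_mult) (auto simp: sums_iff)
  have "summable (\<lambda>d. norm (q * (of_nat (Suc d) * q ^ d)))"
    using 2 by (simp add: norm_mult norm_power del: of_nat_Suc)
  from norm_summable_imp_has_sum[OF this 1]
  have "((\<lambda>d. of_nat (Suc d) * q ^ Suc d) has_sum (q / (1 - q)\<^sup>2)) UNIV"
    by (simp add: mult_ac)
  also have "?this \<longleftrightarrow> ?thesis"
    by (intro has_sum_reindex_bij_witness[of _ "\<lambda>n. n-1" "\<lambda>n. n+1"]) auto
  finally show ?thesis .
qed

text \<open>Both series are the sum of \<open>d q^(m d)\<close> over all \<open>m, d >= 1\<close>,
  grouped by \<open>m\<close> and by \<open>N = m d\<close> respectively. Absolute convergence is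
  checked in the second grouping, whose inner sums are finite.\<close>

lemma lambert_divisor_sum:
  fixes q :: complex
  assumes "norm q < 1"
  shows "(\<lambda>n. q ^ Suc n / (1 - q ^ Suc n)\<^sup>2) sums
           (\<Sum>n. of_nat (divisor_sum 1 (Suc n)) * q ^ Suc n)"
proof -
  let ?f = "\<lambda>(N, d). of_nat d * q ^ N"
  let ?S = "Sigma {1..} (\<lambda>N::nat. {d. d dvd N})"
  have "(\<lambda>(N, d). real d * norm q ^ N) summable_on ?S"
  proof (rule summable_on_SigmaI)
    show "((\<lambda>d. case (N, d) of (N, d) \<Rightarrow> real d * norm q ^ N) has_sum
            (real (divisor_sum 1 N) * norm q ^ N)) {d. d dvd N}" if "N \<in> {1..}" for N
      using that by (intro has_sum_finiteI) (auto simp: divisor_sum_def sum_distrib_right)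
    have "(\<lambda>N. real (divisor_sum 1 N) * norm q ^ N) summable_on UNIV"
      using assms by (intro summable_nonneg_imp_summable_on summable_divisor_sum) auto
    then show "(\<lambda>N. real (divisor_sum 1 N) * norm q ^ N) summable_on {1..}"
      by (rule summable_on_subset) auto
  qed auto
  then have "?f summable_on ?S"
    by (intro Infinite_Sum.abs_summable_summable[of ?f])
       (simp add: case_prod_unfold norm_mult norm_power)
  then obtain s where s: "(?f has_sum s) ?S" by (auto simp: summable_on_def)
  have "((\<lambda>N. of_nat (divisor_sum 1 N) * q ^ N) has_sum s) {1..}"
  proof (rule has_sum_SigmaD[OF s])
    fix N :: nat assume "N \<in> {1..}"
    then show "((\<lambda>d. ?f (N, d)) has_sum of_nat (divisor_sum 1 N) * q ^ N) {d. d dvd N}"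
      by (intro has_sum_finiteI) (auto simp: divisor_sum_def sum_distrib_right)
  qed
  also have "?this \<longleftrightarrow> ((\<lambda>n. of_nat (divisor_sum 1 (Suc n)) * q ^ Suc n) has_sum s) UNIV"
    by (intro has_sum_reindex_bij_witness[of _ "\<lambda>n. n+1" "\<lambda>n. n-1"]) auto
  finally have s': "(\<lambda>n. of_nat (divisor_sum 1 (Suc n)) * q ^ Suc n) sums s"
    by (rule has_sum_imp_sums)
  have "((\<lambda>(m, d). of_nat d * (q ^ m) ^ d) has_sum s) ({1..} \<times> {1..})"
    using s
    by (rule has_sum_reindex_bij_witness[of _ "\<lambda>(m, d). (m * d, d)" "\<lambda>(N, d). (N div d, d)", THEN iffD1, rotated -1])
       (auto simp: Suc_le_eq simp flip: power_mult dest: dvd_pos_nat intro!: div_greater_zero_iff[THEN iffD2] dvd_imp_le)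
  then have "((\<lambda>m. q ^ m / (1 - q ^ m)\<^sup>2) has_sum s) {1..}"
  proof (rule has_sum_SigmaD)
    fix m :: nat assume "m \<in> {1..}"
    then have "norm (q ^ m) < 1"
      using assms by (auto simp: norm_power power_less_one_iff)
    then show "((\<lambda>d. case (m, d) of (m, d) \<Rightarrow> of_nat d * (q ^ m) ^ d) has_sum (q ^ m / (1 - q ^ m)\<^sup>2)) {1..}"
      using has_sum_of_nat_power by simp
  qed
  also have "?this \<longleftrightarrow> ((\<lambda>n. q ^ Suc n / (1 - q ^ Suc n)\<^sup>2) has_sum s) UNIV"
    by (intro has_sum_reindex_bij_witness[of _ "\<lambda>n. n+1" "\<lambda>n. n-1"]) auto
  finally show ?thesis using s' by (auto simp: sums_iff dest: has_sum_imp_sums)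
qed

text \<open>Row 0 is twice zeta(2) and supplies the constant term. Rows \<open>m\<close> and
  \<open>- m\<close> agree, and the Lambert series adds them up; the coefficient -24 is
  \<open>2 * (- 4 pi^2)\<close> divided by \<open>pi^2 / 3\<close>.\<close>

lemma lattice_sum2_eq_E2:
  assumes "Im z > 0"
  shows "lattice_sum2 z = of_real (pi\<^sup>2 / 3) * eisenstein_E2 z"
proof -
  define q where "q = nome z"
  have q: "norm q < 1" using norm_nome_less_1[OF assms] by (simp add: q_def)
  define T where "T = (\<Sum>n. of_nat (divisor_sum 1 (Suc n)) * q ^ Suc n)"
  define R where "R n = - 4 * (complex_of_real pi)\<^sup>2 * (q ^ Suc n / (1 - q ^ Suc n)\<^sup>2)" for n
  have row: "lattice_row z (int (Suc n)) = R n" "lattice_row z (- 1 - int n) = R n" for n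
  proof -
    have n: "Im (of_nat (Suc n) * z) > 0" using assms by (auto intro!: mult_pos_pos)
    have "lattice_row z (int (Suc n)) = (of_real pi / sin (of_real pi * (of_nat (Suc n) * z)))\<^sup>2"
      by (subst lattice_row_nonzero) (use assms in auto)
    also have "\<dots> = R n"
      unfolding cosecant_square_nome[OF n] nome_of_nat_mult R_def q_def ..
    finally show 1: "lattice_row z (int (Suc n)) = R n" .
    have "of_real pi * (of_int (- 1 - int n) * z) = - (of_real pi * (of_int (int (Suc n)) * z))"
      by (simp add: algebra_simps)
    then have "lattice_row z (- 1 - int n) = lattice_row z (int (Suc n))"
      using assms
      by (subst (1 2) lattice_row_nonzero) (simp_all add: power_divide del: of_nat_Suc of_int_of_nat_eq)
    with 1 show "lattice_row z (- 1 - int n) = R n" by simp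
  qed
  have R: "(\<lambda>N. \<Sum>n<N. R n) \<longlonglongrightarrow> - 4 * (of_real pi)\<^sup>2 * T"
    unfolding R_def sum_distrib_left[symmetric]
    using lambert_divisor_sum[OF q] unfolding T_def sums_def by (intro tendsto_mult tendsto_const)
  have "(\<lambda>N. \<Sum>n\<in>{- int (Suc N)..<int (Suc N)}. lattice_row z n) \<longlonglongrightarrow> lattice_sum2 z"
    by (rule LIMSEQ_Suc[OF has_sum_int_symmetric[OF has_sum_lattice_row[OF assms]]])
  moreover have "(\<Sum>n\<in>{- int (Suc N)..<int (Suc N)}. lattice_row z n) =
      lattice_row z 0 + (\<Sum>n<N. R n) + (\<Sum>n<Suc N. R n)" for N
    unfolding sum_int_symmetric_split sum.lessThan_Suc_shift[of "\<lambda>n. lattice_row z (int n)"] row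
    by simp
  moreover have "(\<lambda>N. lattice_row z 0 + (\<Sum>n<N. R n) + (\<Sum>n<Suc N. R n)) \<longlonglongrightarrow>
      lattice_row z 0 + - 4 * (of_real pi)\<^sup>2 * T + - 4 * (of_real pi)\<^sup>2 * T"
    by (intro tendsto_add tendsto_const R LIMSEQ_Suc[OF R])
  ultimately have "lattice_sum2 z = lattice_row z 0 + - 4 * (of_real pi)\<^sup>2 * T + - 4 * (of_real pi)\<^sup>2 * T"
    by (simp only: LIMSEQ_unique)
  also have "\<dots> = of_real (pi\<^sup>2 / 3) * eisenstein_E2 z"
    using assms
    by (simp add: lattice_row_0 eisenstein_E2_def upper_half_plane_def T_def q_def algebra_simps)
  finally show ?thesis .
qed

text \<open>A rescaling of \<open>lattice_sum2_S\<close>; the anomalous term stems from the column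
  sums of the telescoping terms.\<close>

theorem eisenstein_E2_S:
  assumes "Im z > 0"
  shows "eisenstein_E2 (- 1 / z) = z\<^sup>2 * eisenstein_E2 z + 12 * z / (2 * of_real pi * \<i>)"
proof -
  have z0: "z \<noteq> 0" using assms by auto
  define P where "P = complex_of_real pi"
  have P0: "P \<noteq> 0" by (simp add: P_def)
  have "P\<^sup>2 / 3 * eisenstein_E2 (- 1 / z) / z\<^sup>2 = P\<^sup>2 / 3 * eisenstein_E2 z - 2 * P * \<i> / z"
    using lattice_sum2_S[OF assms] assms Im_S_pos[OF assms]
    by (simp only: lattice_sum2_eq_E2 P_def of_real_divide of_real_power of_real_numeral)
  moreover have "eisenstein_E2 (- 1 / z) = 3 * z\<^sup>2 / P\<^sup>2 * (P\<^sup>2 / 3 * eisenstein_E2 (- 1 / z) / z\<^sup>2)"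
    using z0 P0 by simp
  ultimately have "eisenstein_E2 (- 1 / z) = 3 * z\<^sup>2 / P\<^sup>2 * (P\<^sup>2 / 3 * eisenstein_E2 z - 2 * P * \<i> / z)"
    by simp
  also have "\<dots> = z\<^sup>2 * eisenstein_E2 z + 12 * z / (2 * P * \<i>)"
    using z0 P0 by (simp add: field_simps power2_eq_square)
  finally show ?thesis by (simp add: P_def)
qed

section \<open>Modular forms as power series in the nome\<close>

definition disc_fps :: "complex fps set" where
  "disc_fps = {A. fps_conv_radius A \<ge> 1}"

text \<open>The value 0 off the half-plane matches the convention of \<open>modular_forms\<close>.
  Forms are handled through their expansions from here on, where products and \<open>q d/dq\<close>
  are algebraic operations.\<close>

definition hfun :: "complex fps \<Rightarrow> complex \<Rightarrow> complex" where
  "hfun A z = (if z \<in> upper_half_plane then eval_fps A (nome z) else 0)"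

lemma disc_fps_conv_radius: "A \<in> disc_fps \<Longrightarrow> norm (q::complex) < 1 \<Longrightarrow> ereal (norm q) < fps_conv_radius A"
  unfolding disc_fps_def by (auto simp: one_ereal_def intro: less_le_trans[of _ "ereal 1"])

lemma disc_fps_intros [simp, intro]:
  "fps_const c \<in> disc_fps" "0 \<in> disc_fps" "1 \<in> disc_fps" "numeral k \<in> disc_fps" "fps_X \<in> disc_fps"
  "A \<in> disc_fps \<Longrightarrow> fps_deriv A \<in> disc_fps"
  "A \<in> disc_fps \<Longrightarrow> - A \<in> disc_fps"
  "A \<in> disc_fps \<Longrightarrow> fps_shift n A \<in> disc_fps"
  "A \<in> disc_fps \<Longrightarrow> A ^ n \<in> disc_fps"
  "A \<in> disc_fps \<Longrightarrow> B \<in> disc_fps \<Longrightarrow> A + B \<in> disc_fps"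
  "A \<in> disc_fps \<Longrightarrow> B \<in> disc_fps \<Longrightarrow> A - B \<in> disc_fps"
  "A \<in> disc_fps \<Longrightarrow> B \<in> disc_fps \<Longrightarrow> A * B \<in> disc_fps"
  using fps_conv_radius_deriv[of A] fps_conv_radius_power[of A n] fps_conv_radius_add[of A B]
    fps_conv_radius_diff[of A B] fps_conv_radius_mult[of A B]
  by (auto simp: disc_fps_def intro: order_trans[OF min.boundedI])

lemma nome_in_disc: "z \<in> upper_half_plane \<Longrightarrow> norm (nome z) < 1"
  by (simp add: norm_nome_less_1 upper_half_plane_def)

lemma hfun_simps:
  assumes "z \<in> upper_half_plane"
  shows "hfun (fps_const c) z = c" "hfun 0 z = 0" "hfun 1 z = 1"
    "A \<in> disc_fps \<Longrightarrow> B \<in> disc_fps \<Longrightarrow> hfun (A + B) z = hfun A z + hfun B z"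
    "A \<in> disc_fps \<Longrightarrow> B \<in> disc_fps \<Longrightarrow> hfun (A - B) z = hfun A z - hfun B z"
    "A \<in> disc_fps \<Longrightarrow> B \<in> disc_fps \<Longrightarrow> hfun (A * B) z = hfun A z * hfun B z"
  using assms nome_in_disc[OF assms]
  by (auto simp: hfun_def eval_fps_add eval_fps_diff eval_fps_mult disc_fps_conv_radius)

lemma has_fourier_expansion_hfun:
  assumes "A \<in> disc_fps"
  shows "has_fourier_expansion (hfun A) (fps_nth A)"
  unfolding has_fourier_expansion_def hfun_def
  by (auto intro!: sums_eval_fps disc_fps_conv_radius assms nome_in_disc)

lemma fourier_coeff_hfun: "A \<in> disc_fps \<Longrightarrow> fourier_coeff (hfun A) = fps_nth A"
  by (intro fourier_coeff_eqI has_fourier_expansion_hfun)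

lemma hfun_inject: "A \<in> disc_fps \<Longrightarrow> B \<in> disc_fps \<Longrightarrow> hfun A = hfun B \<Longrightarrow> A = B"
  by (metis fourier_coeff_hfun fps_nth_inject)

lemma hfun_eqI:
  assumes "A \<in> disc_fps" "B \<in> disc_fps" "\<And>z. z \<in> upper_half_plane \<Longrightarrow> hfun A z = hfun B z"
  shows "A = B"
  using assms by (intro hfun_inject) (auto simp: hfun_def fun_eq_iff)

lemma disc_fps_summableI:
  assumes "\<And>q::complex. 0 < norm q \<Longrightarrow> norm q < 1 \<Longrightarrow> summable (\<lambda>n. fps_nth A n * q ^ n)"
  shows "A \<in> disc_fps"
proof -
  have "conv_radius (fps_nth A) \<ge> ereal 1"
  proof (rule conv_radius_geI_ex')
    fix r :: real assume "0 < r" "ereal r < ereal 1"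
    then show "summable (\<lambda>n. fps_nth A n * of_real r ^ n)" by (intro assms) auto
  qed
  then show ?thesis by (simp add: disc_fps_def fps_conv_radius_def one_ereal_def)
qed

lemma has_fourier_expansion_imp_hfun:
  assumes "has_fourier_expansion f a" "\<And>z. z \<notin> upper_half_plane \<Longrightarrow> f z = 0"
  shows "Abs_fps a \<in> disc_fps" "f = hfun (Abs_fps a)"
proof -
  show "Abs_fps a \<in> disc_fps"
  proof (rule disc_fps_summableI)
    fix q :: complex assume "0 < norm q" "norm q < 1"
    from nome_surj[OF this] obtain z where "z \<in> upper_half_plane" "nome z = q" .
    with assms show "summable (\<lambda>n. fps_nth (Abs_fps a) n * q ^ n)"
      unfolding has_fourier_expansion_def by (auto simp: sums_iff)
  qed
  show "f = hfun (Abs_fps a)"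
    using assms unfolding has_fourier_expansion_def
    by (auto simp: hfun_def eval_fps_def sums_iff fun_eq_iff)
qed

lemma nome_has_field_derivative: "(nome has_field_derivative 2 * of_real pi * \<i> * nome z) (at z)"
  unfolding nome_def[abs_def] by (auto intro!: derivative_eq_intros)

lemma hfun_has_field_derivative:
  assumes "A \<in> disc_fps" "z \<in> upper_half_plane"
  shows "(hfun A has_field_derivative 2 * of_real pi * \<i> * hfun (fps_X * fps_deriv A) z) (at z)"
proof (rule has_field_derivative_transform_within_open)
  have q: "ereal (norm (nome z)) < fps_conv_radius A"
    by (intro disc_fps_conv_radius nome_in_disc assms)
  have "((\<lambda>z. eval_fps A (nome z)) has_field_derivative
          eval_fps (fps_deriv A) (nome z) * (2 * of_real pi * \<i> * nome z)) (at z)"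
    by (rule DERIV_chain2[OF has_field_derivative_eval_fps nome_has_field_derivative])
       (use q in auto)
  also have "eval_fps (fps_deriv A) (nome z) * (2 * of_real pi * \<i> * nome z) =
     2 * of_real pi * \<i> * hfun (fps_X * fps_deriv A) z"
    using assms by (simp add: hfun_def eval_fps_mult disc_fps_conv_radius nome_in_disc)
  finally show "((\<lambda>z. eval_fps A (nome z)) has_field_derivative
     2 * of_real pi * \<i> * hfun (fps_X * fps_deriv A) z) (at z)" .
  show "open upper_half_plane"
    unfolding upper_half_plane_def by (rule open_halfspace_Im_gt)
qed (use assms in \<open>auto simp: hfun_def\<close>)

lemma hfun_plus_of_int: "hfun A (z + of_int k) = hfun A z"
proof -
  have "nome (z + of_int k) = nome z"
    using exp_integer_2pi[of "of_int k"] by (simp add: nome_def algebra_simps exp_add)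
  then show ?thesis by (simp add: hfun_def upper_half_plane_def)
qed

text \<open>Invariance under \<open>z \<mapsto> z + 1\<close> is built into a series in the nome, so
  only the law for the other generator of the modular group is demanded.\<close>

definition modular_fps :: "int \<Rightarrow> complex fps set" where
  "modular_fps w = {A \<in> disc_fps. \<forall>z\<in>upper_half_plane. hfun A (- 1 / z) = z powi w * hfun A z}"

lemma S_upper_half_plane:
  "z \<in> upper_half_plane \<Longrightarrow> - 1 / z \<in> upper_half_plane"
  "z \<in> upper_half_plane \<Longrightarrow> - (1 / z) \<in> upper_half_plane"
  using Im_S_pos by (simp_all add: upper_half_plane_def)

lemma upper_half_plane_nonzero: "z \<in> upper_half_plane \<Longrightarrow> z \<noteq> 0"
  by (auto simp: upper_half_plane_def)

lemma powi_minus_even: "even w \<Longrightarrow> (- x) powi w = (x :: complex) powi w"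
  by (cases w rule: int_cases3) (auto simp: power_int_minus power_minus_even)

text \<open>Euclid's algorithm on the bottom row: for \<open>k = d div c\<close> the matrix is a
  product of one with rows \<open>(b', - a)\<close> and \<open>(d', - c)\<close>, of
  \<open>S\<close>, and of the translation by \<open>k\<close>, and \<open>|d'| < |c|\<close>. For
  \<open>c = 0\<close> a translation up to sign remains, and the sign is harmless in even
  weight.\<close>

lemma modular_fps_modular:
  fixes a b c d :: int
  assumes A: "A \<in> modular_fps w" and w: "even w" and z: "z \<in> upper_half_plane" and det: "a * d - b * c = 1"
  shows "hfun A ((of_int a * z + of_int b) / (of_int c * z + of_int d)) =
           (of_int c * z + of_int d) powi w * hfun A z"
  using z det
proof (induction "nat \<bar>c\<bar>" arbitrary: a b c d z rule: less_induct)
  case less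
  have z0: "z \<noteq> 0" using upper_half_plane_nonzero[OF less.prems(1)] .
  show ?case
  proof (cases "c = 0")
    case True
    with less.prems have "a * d = 1" by simp
    then have "a = 1 \<and> d = 1 \<or> a = - 1 \<and> d = - 1" by (simp add: zmult_eq_1_iff)
    then show ?thesis
    proof (elim disjE conjE)
      assume ad: "a = 1" "d = 1"
      then show ?thesis using True hfun_plus_of_int[of A z b] by simp
    next
      assume ad: "a = - 1" "d = - 1"
      then have "(of_int a * z + of_int b) / (of_int c * z + of_int d) = z + of_int (- b)"
        using True by simp
      then show ?thesis using True ad w hfun_plus_of_int[of A z "- b"]
        by (simp add: powi_minus_even)
    qed
  next
    case False
    define k where "k = d div c"
    define b' d' where "b' = b - a * k" and "d' = d - c * k"
    have "d' = d mod c" by (simp add: d'_def k_def minus_mult_div_eq_mod)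
    then have "nat \<bar>d'\<bar> < nat \<bar>c\<bar>"
      using False abs_mod_less[of c d] by simp
    define y where "y = z + of_int k"
    define z' where "z' = - 1 / y"
    have y: "y \<in> upper_half_plane"
      using less.prems by (simp add: y_def upper_half_plane_def)
    have y0: "y \<noteq> 0" using upper_half_plane_nonzero[OF y] .
    have z': "z' \<in> upper_half_plane" unfolding z'_def by (rule S_upper_half_plane(1)[OF y])
    have "b' * (- c) - (- a) * d' = 1"
      using less.prems(2) by (simp add: b'_def d'_def algebra_simps)
    from less.hyps[OF \<open>nat \<bar>d'\<bar> < nat \<bar>c\<bar>\<close> z' this]
    have IH: "hfun A ((of_int b' * z' + of_int (- a)) / (of_int d' * z' + of_int (- c))) =
                (of_int d' * z' + of_int (- c)) powi w * hfun A z'" .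
    have num: "of_int b' * z' + of_int (- a) = - (of_int a * z + of_int b) / y"
    proof -
      have "of_int b' + of_int a * y = of_int a * z + of_int b"
        by (simp add: b'_def y_def algebra_simps)
      then have "- (of_int a * z + of_int b) / y = - (of_int b' + of_int a * y) / y" by simp
      also have "\<dots> = of_int b' * z' + of_int (- a)"
        using y0 by (simp add: z'_def divide_simps)
      finally show ?thesis ..
    qed
    have den: "of_int d' * z' + of_int (- c) = - (of_int c * z + of_int d) / y"
    proof -
      have "of_int d' + of_int c * y = of_int c * z + of_int d"
        by (simp add: d'_def y_def algebra_simps)
      then have "- (of_int c * z + of_int d) / y = - (of_int d' + of_int c * y) / y" by simp
      also have "\<dots> = of_int d' * z' + of_int (- c)"
        using y0 by (simp add: z'_def divide_simps)
      finally show ?thesis ..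
    qed
    have "hfun A ((of_int a * z + of_int b) / (of_int c * z + of_int d)) =
            hfun A ((of_int b' * z' + of_int (- a)) / (of_int d' * z' + of_int (- c)))"
    proof -
      have "(- u / y) / (- v / y) = u / v" for u v using y0 by simp
      then show ?thesis unfolding num den by (simp only:)
    qed
    also have "\<dots> = (- (of_int c * z + of_int d) / y) powi w * hfun A z'"
      using IH by (simp only: den)
    also have "hfun A z' = y powi w * hfun A y"
      using A y by (simp add: modular_fps_def z'_def)
    also have "hfun A y = hfun A z" by (simp add: y_def hfun_plus_of_int)
    also have "(- (of_int c * z + of_int d) / y) powi w * (y powi w * hfun A z) =
        (of_int c * z + of_int d) powi w * hfun A z"
      unfolding power_int_divide_distrib powi_minus_even[OF w] using y0 by simp
    finally show ?thesis .
  qed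
qed

lemma hfun_holomorphic: "A \<in> disc_fps \<Longrightarrow> hfun A holomorphic_on upper_half_plane"
  using hfun_has_field_derivative
  by (intro holomorphic_onI) (metis field_differentiable_at_within field_differentiable_def)

lemma modular_forms_eq_modular_fps:
  assumes "even w"
  shows "modular_forms w = hfun ` modular_fps w"
proof (intro set_eqI iffI)
  fix f assume f: "f \<in> modular_forms w"
  then obtain a where a: "has_fourier_expansion f a"
    and 0: "\<And>z. z \<notin> upper_half_plane \<Longrightarrow> f z = 0"
    unfolding modular_forms_def by blast
  have "Abs_fps a \<in> modular_fps w"
    unfolding modular_fps_def
  proof safe
    show "Abs_fps a \<in> disc_fps" by (rule has_fourier_expansion_imp_hfun[OF a 0])
    fix z assume z: "z \<in> upper_half_plane"
    have "\<forall>z\<in>upper_half_plane. f ((of_int 0 * z + of_int (- 1)) / (of_int 1 * z + of_int 0)) =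
             (of_int 1 * z + of_int 0) powi w * f z"
      using f unfolding modular_forms_def
      by (elim CollectE conjE allE[of _ 0] allE[of _ "-1"] allE[of _ 1]) simp
    with z have "f (- 1 / z) = z powi w * f z" by simp
    then show "hfun (Abs_fps a) (- 1 / z) = z powi w * hfun (Abs_fps a) z"
      using has_fourier_expansion_imp_hfun[OF a 0] by simp
  qed
  then show "f \<in> hfun ` modular_fps w" using has_fourier_expansion_imp_hfun(2)[OF a 0] by blast
next
  fix f assume "f \<in> hfun ` modular_fps w"
  then obtain A where A: "A \<in> modular_fps w" "f = hfun A" by blast
  then have d: "A \<in> disc_fps" by (simp add: modular_fps_def)
  show "f \<in> modular_forms w"
    unfolding modular_forms_def A(2)
    by (intro CollectI conjI allI impI ballI exI[of _ "fps_nth A"] modular_fps_modular[OF A(1) assms]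
          hfun_holomorphic[OF d] has_fourier_expansion_hfun[OF d]) (simp_all add: hfun_def)
qed

lemma modular_fps_disc_fps: "A \<in> modular_fps w \<Longrightarrow> A \<in> disc_fps"
  by (simp add: modular_fps_def)

lemma modular_fps_0 [simp, intro]: "0 \<in> modular_fps w"
  by (auto simp: modular_fps_def hfun_simps S_upper_half_plane)

lemma modular_fps_1: "1 \<in> modular_fps 0"
  by (auto simp: modular_fps_def hfun_simps S_upper_half_plane)

lemma modular_fps_add: "A \<in> modular_fps w \<Longrightarrow> B \<in> modular_fps w \<Longrightarrow> A + B \<in> modular_fps w"
  by (auto simp: modular_fps_def hfun_simps S_upper_half_plane algebra_simps)

lemma modular_fps_diff: "A \<in> modular_fps w \<Longrightarrow> B \<in> modular_fps w \<Longrightarrow> A - B \<in> modular_fps w"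
  by (auto simp: modular_fps_def hfun_simps S_upper_half_plane algebra_simps)

lemma modular_fps_const_mult: "A \<in> modular_fps w \<Longrightarrow> fps_const c * A \<in> modular_fps w"
  by (auto simp: modular_fps_def hfun_simps S_upper_half_plane)

lemma modular_fps_mult: "A \<in> modular_fps v \<Longrightarrow> B \<in> modular_fps w \<Longrightarrow> v + w = u \<Longrightarrow> A * B \<in> modular_fps u"
  by (auto simp: modular_fps_def hfun_simps S_upper_half_plane power_int_add[OF disjI1] upper_half_plane_nonzero)

text \<open>The chain rule for \<open>z \<mapsto> - 1 / z\<close>. The right side \<open>R\<close>
  is arbitrary, so that the lemma covers the laws of modular forms as well as the inhomogeneous law
  of \<open>E2\<close>.\<close>

lemma hfun_deriv_S:
  assumes A: "A \<in> disc_fps" and z: "z \<in> upper_half_plane"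
    and eq: "\<And>z. z \<in> upper_half_plane \<Longrightarrow> hfun A (- 1 / z) = R z"
    and R: "(R has_field_derivative R') (at z)"
  shows "hfun (fps_X * fps_deriv A) (- 1 / z) = z\<^sup>2 * R' / (2 * of_real pi * \<i>)"
proof -
  have z0: "z \<noteq> 0" by (rule upper_half_plane_nonzero[OF z])
  have "((\<lambda>z. hfun A (- 1 / z)) has_field_derivative
      2 * of_real pi * \<i> * hfun (fps_X * fps_deriv A) (- 1 / z) * (1 / z\<^sup>2)) (at z)"
    by (rule DERIV_chain2[where g = "\<lambda>z. - 1 / z", OF hfun_has_field_derivative[OF A S_upper_half_plane(1)[OF z]]])
       (use z0 in \<open>auto intro!: derivative_eq_intros simp: power2_eq_square\<close>)
  moreover have "((\<lambda>z. hfun A (- 1 / z)) has_field_derivative R') (at z)"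
    using R by (rule has_field_derivative_transform_within_open[where S = upper_half_plane])
      (use z eq open_halfspace_Im_gt[of 0] in \<open>auto simp: upper_half_plane_def\<close>)
  ultimately have "2 * of_real pi * \<i> * hfun (fps_X * fps_deriv A) (- 1 / z) * (1 / z\<^sup>2) = R'"
    by (rule DERIV_unique)
  then show ?thesis using z0 by (auto simp: field_simps)
qed

section \<open>The Eisenstein series of weights 2, 4 and 6 and the Serre derivative\<close>

definition E2 :: "complex fps" where
  "E2 = Abs_fps (\<lambda>n. if n = 0 then 1 else - 24 * of_nat (divisor_sum 1 n))"

lemma summable_divisor_sum_complex:
  fixes q :: complex
  assumes "norm q < 1"
  shows "summable (\<lambda>n. of_nat (divisor_sum 1 n) * q ^ n)"
  by (rule summable_norm_cancel)
     (use summable_divisor_sum[of "norm q"] assms in \<open>simp add: norm_mult norm_power\<close>)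

lemma sums_E2:
  assumes "norm q < 1"
  shows "(\<lambda>n. fps_nth E2 n * q ^ n) sums
           (1 - 24 * (\<Sum>n. of_nat (divisor_sum 1 (Suc n)) * q ^ Suc n))"
proof -
  have "summable (\<lambda>n. of_nat (divisor_sum 1 (Suc n)) * q ^ Suc n)"
    using summable_divisor_sum_complex[OF assms] by (subst summable_Suc_iff)
  then have "(\<lambda>n. - 24 * (of_nat (divisor_sum 1 (Suc n)) * q ^ Suc n)) sums
      (- 24 * (\<Sum>n. of_nat (divisor_sum 1 (Suc n)) * q ^ Suc n))"
    by (intro sums_mult summable_sums)
  then have "(\<lambda>n. fps_nth E2 (Suc n) * q ^ Suc n) sums
      (- 24 * (\<Sum>n. of_nat (divisor_sum 1 (Suc n)) * q ^ Suc n))"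
    by (simp add: E2_def mult_ac)
  then have "(\<lambda>n. fps_nth E2 n * q ^ n) sums
      (- 24 * (\<Sum>n. of_nat (divisor_sum 1 (Suc n)) * q ^ Suc n) + fps_nth E2 0 * q ^ 0)"
    by (rule sums_Suc)
  then show ?thesis by (simp add: E2_def)
qed

lemma E2_disc_fps [simp, intro]: "E2 \<in> disc_fps"
  using sums_E2 by (intro disc_fps_summableI) (auto simp: sums_iff)

lemma hfun_E2: "hfun E2 = eisenstein_E2"
  using sums_E2 nome_in_disc
  by (auto simp: fun_eq_iff hfun_def eisenstein_E2_def eval_fps_def sums_iff)

lemma hfun_E2_S:
  assumes "z \<in> upper_half_plane"
  shows "hfun E2 (- 1 / z) = z\<^sup>2 * hfun E2 z + 12 * z / (2 * of_real pi * \<i>)"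
  using eisenstein_E2_S[of z] assms by (simp add: hfun_E2 upper_half_plane_def)

definition serre_deriv :: "int \<Rightarrow> complex fps \<Rightarrow> complex fps" where
  "serre_deriv w A = fps_X * fps_deriv A - fps_const (of_int w / 12) * E2 * A"

text \<open>Differentiating the factor \<open>z powi w\<close> leaves an extra term
  \<open>w z A / (2 pi i)\<close>, up to that factor, which cancels against the anomalous term of
  \<open>E2\<close> multiplied by \<open>w / 12\<close>.\<close>

lemma serre_deriv_modular_fps:
  assumes "A \<in> modular_fps w"
  shows "serre_deriv w A \<in> modular_fps (w + 2)"
proof -
  have A: "A \<in> disc_fps" using assms by (rule modular_fps_disc_fps)
  have "hfun (serre_deriv w A) (- 1 / z) = z powi (w + 2) * hfun (serre_deriv w A) z"
    if z: "z \<in> upper_half_plane" for z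
  proof -
    define P where "P = 2 * complex_of_real pi * \<i>"
    have P: "P \<noteq> 0" by (simp add: P_def)
    have z0: "z \<noteq> 0" by (rule upper_half_plane_nonzero[OF z])
    define Z where "Z = z powi w"
    have Z: "z powi (w - 1) = Z / z" "z powi (w + 2) = Z * z\<^sup>2"
      using z0 by (simp_all add: Z_def power_int_diff power_int_add)
    have "hfun (fps_X * fps_deriv A) (- 1 / z) =
       z\<^sup>2 * (of_int w * z powi (w - 1) * hfun A z + z powi w * (P * hfun (fps_X * fps_deriv A) z)) / P"
      unfolding P_def
      by (rule hfun_deriv_S[OF A z, where R = "\<lambda>z. z powi w * hfun A z"])
         (use assms z0 in \<open>auto simp: modular_fps_def intro!: derivative_eq_intros hfun_has_field_derivative[OF A z]\<close>)
    also have "\<dots> = Z * (z\<^sup>2 * hfun (fps_X * fps_deriv A) z + of_int w * z * hfun A z / P)"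
      unfolding Z Z_def[symmetric] using P z0
      by (simp add: divide_simps power2_eq_square) (simp add: algebra_simps)
    finally have 1: "hfun (fps_X * fps_deriv A) (- 1 / z) =
      Z * (z\<^sup>2 * hfun (fps_X * fps_deriv A) z + of_int w * z * hfun A z / P)" .
    have 2: "hfun A (- 1 / z) = Z * hfun A z" using assms z by (simp add: modular_fps_def Z_def)
    have d: "fps_X * fps_deriv A \<in> disc_fps" "fps_const (of_int w / 12) * E2 * A \<in> disc_fps"
      "fps_const (of_int w / 12) * E2 \<in> disc_fps" using A by auto
    have ev: "hfun (serre_deriv w A) y = hfun (fps_X * fps_deriv A) y - of_int w / 12 * hfun E2 y * hfun A y"
      if "y \<in> upper_half_plane" for y
      using that A d unfolding serre_deriv_def
      by (simp add: hfun_simps del: fps_mult_fps_X_commute)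
    show ?thesis
      unfolding ev[OF z] ev[OF S_upper_half_plane(1)[OF z]] 1 2 hfun_E2_S[OF z] P_def[symmetric] Z
      by (simp add: algebra_simps power2_eq_square)
  qed
  with A show ?thesis by (auto simp: modular_fps_def serre_deriv_def)
qed

text \<open>Ramanujan's formula for the derivative of \<open>E2\<close>, solved for
  \<open>E4\<close> and taken as its definition; \<open>E6\<close> arises likewise from the formula
  for the derivative of \<open>E4\<close>.\<close>

definition E4 :: "complex fps" where
  "E4 = E2 * E2 - fps_const 12 * (fps_X * fps_deriv E2)"

definition E6 :: "complex fps" where
  "E6 = E2 * E4 - fps_const 3 * (fps_X * fps_deriv E4)"

text \<open>The anomalous terms of \<open>E2 * E2\<close> and of 12 times the derivative of
  \<open>E2\<close> are equal, hence cancel.\<close>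

lemma E4_modular_fps: "E4 \<in> modular_fps 4"
proof -
  have "hfun E4 (- 1 / z) = z powi 4 * hfun E4 z" if z: "z \<in> upper_half_plane" for z
  proof -
    define P where "P = 2 * complex_of_real pi * \<i>"
    have P: "P \<noteq> 0" by (simp add: P_def)
    have 1: "hfun (fps_X * fps_deriv E2) (- 1 / z) =
       z\<^sup>2 * (2 * z * hfun E2 z + z\<^sup>2 * (P * hfun (fps_X * fps_deriv E2) z) + 12 / P) / P"
      unfolding P_def
      by (rule hfun_deriv_S[OF _ z hfun_E2_S])
         (auto intro!: derivative_eq_intros hfun_has_field_derivative[OF _ z])
    have ev: "hfun E4 y = hfun E2 y * hfun E2 y - 12 * hfun (fps_X * fps_deriv E2) y"
      if "y \<in> upper_half_plane" for y
    proof -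
      have "fps_X * fps_deriv E2 \<in> disc_fps" by auto
      then show ?thesis
        using that unfolding E4_def by (simp add: hfun_simps del: fps_mult_fps_X_commute)
    qed
    define e d where "e = hfun E2 z" and "d = hfun (fps_X * fps_deriv E2) z"
    have "(z\<^sup>2 * e + 12 * z / P) * (z\<^sup>2 * e + 12 * z / P)
        - 12 * (z\<^sup>2 * (2 * z * e + z\<^sup>2 * (P * d) + 12 / P) / P) = z ^ 4 * (e * e - 12 * d)"
      using P by (simp add: divide_simps) algebra
    then show ?thesis
      unfolding ev[OF z] ev[OF S_upper_half_plane(1)[OF z]] 1 hfun_E2_S[OF z] P_def[symmetric]
        e_def d_def by simp
  qed
  then show ?thesis by (auto simp: modular_fps_def E4_def)
qed

lemma E6_modular_fps: "E6 \<in> modular_fps 6"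
proof -
  have "E6 = fps_const (- 3) * serre_deriv 4 E4"
    unfolding E6_def serre_deriv_def right_diff_distrib mult.assoc[symmetric] fps_const_mult
    by (simp add: algebra_simps flip: fps_const_neg)
  then show ?thesis
    using modular_fps_const_mult[OF serre_deriv_modular_fps[OF E4_modular_fps], of "- 3"] by simp
qed

section \<open>Vanishing of modular forms of high order at the cusp\<close>

text \<open>The formal integral of \<open>(E2 - 1) / q\<close>, that is, 24 times the sum of all
  \<open>log (1 - q^n)\<close>. Its constant term is 0 because division by 0 yields 0.\<close>

definition log_discr_fps :: "complex fps" where
  "log_discr_fps = Abs_fps (\<lambda>n. - 24 * of_nat (divisor_sum 1 n) / of_nat n)"

text \<open>
  This is \<open>q \<Prod>(1 - q\<^sup>n)\<^sup>2\<^sup>4\<close>. The exponential form makes it evident that it has no zeros and that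
  its logarithmic derivative is \<open>E\<^sub>2\<close>.
\<close>

definition discr :: "complex \<Rightarrow> complex" where
  "discr z = nome z * exp (eval_fps log_discr_fps (nome z))"

lemma log_discr_disc_fps: "log_discr_fps \<in> disc_fps"
proof (rule disc_fps_summableI)
  fix q :: complex assume q: "norm q < 1"
  have "summable (\<lambda>n. 24 * (real (divisor_sum 1 n) * norm q ^ n))"
    using q by (intro summable_mult summable_divisor_sum) auto
  then show "summable (\<lambda>n. fps_nth log_discr_fps n * q ^ n)"
  proof (rule summable_comparison_test'[where N = 0])
    fix n :: nat
    have "real (divisor_sum 1 n) / real n \<le> real (divisor_sum 1 n)"
      by (cases n) (auto simp: divide_simps mult_le_cancel_left1)
    then have "24 * (real (divisor_sum 1 n) / real n * norm q ^ n) \<le> 24 * (real (divisor_sum 1 n) * norm q ^ n)"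
      by (intro mult_left_mono mult_right_mono) auto
    then show "norm (fps_nth log_discr_fps n * q ^ n) \<le> 24 * (real (divisor_sum 1 n) * norm q ^ n)"
      by (simp add: log_discr_fps_def norm_mult norm_divide norm_power)
  qed
qed

lemma log_discr_deriv: "1 + fps_X * fps_deriv log_discr_fps = E2"
  by (rule fps_ext) (simp add: log_discr_fps_def E2_def fps_X_mult_nth)

lemma discr_nonzero [simp]: "discr z \<noteq> 0"
  by (simp add: discr_def)

lemma discr_has_field_derivative:
  assumes "z \<in> upper_half_plane"
  shows "(discr has_field_derivative 2 * of_real pi * \<i> * hfun E2 z * discr z) (at z)"
proof -
  have q: "norm (nome z) < 1" using nome_in_disc[OF assms] .
  have c: "ereal (norm (nome z)) < fps_conv_radius log_discr_fps"
    by (rule disc_fps_conv_radius[OF log_discr_disc_fps q])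
  have "((\<lambda>z. eval_fps log_discr_fps (nome z)) has_field_derivative
          eval_fps (fps_deriv log_discr_fps) (nome z) * (2 * of_real pi * \<i> * nome z)) (at z)"
    by (rule DERIV_chain2[OF has_field_derivative_eval_fps nome_has_field_derivative])
       (use c in auto)
  from DERIV_mult[OF nome_has_field_derivative DERIV_chain2[OF DERIV_exp this]]
  have "(discr has_field_derivative
      2 * of_real pi * \<i> * (1 + nome z * eval_fps (fps_deriv log_discr_fps) (nome z)) * discr z) (at z)"
    unfolding discr_def by (simp add: algebra_simps)
  moreover have "hfun E2 z = 1 + nome z * eval_fps (fps_deriv log_discr_fps) (nome z)"
  proof -
    have d: "fps_X * fps_deriv log_discr_fps \<in> disc_fps"
      using log_discr_disc_fps by (intro disc_fps_intros)
    have "hfun E2 z = hfun 1 z + hfun (fps_X * fps_deriv log_discr_fps) z"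
      unfolding log_discr_deriv[symmetric] by (rule hfun_simps(4)[OF assms _ d]) auto
    also have "hfun (fps_X * fps_deriv log_discr_fps) z = nome z * eval_fps (fps_deriv log_discr_fps) (nome z)"
      using assms log_discr_disc_fps q by (simp add: hfun_def eval_fps_mult disc_fps_conv_radius)
    finally show ?thesis using assms by (simp add: hfun_simps)
  qed
  ultimately show ?thesis by simp
qed

text \<open>By the law of \<open>E2\<close>, numerator and denominator of \<open>?u\<close> have the
  same logarithmic derivative, so the quotient is constant on the half-plane. At the fixed point
  \<open>\<i>\<close> of \<open>S\<close> it equals \<open>1 / \<i> ^ 12 = 1\<close>.\<close>

lemma discr_S:
  assumes "z \<in> upper_half_plane"
  shows "discr (- 1 / z) = z ^ 12 * discr z"
proof -
  let ?u = "\<lambda>z. discr (- 1 / z) / (z ^ 12 * discr z)"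
  have "(?u has_field_derivative 0) (at z)" if z: "z \<in> upper_half_plane" for z
  proof -
    define P where "P = 2 * complex_of_real pi * \<i>"
    have P: "P \<noteq> 0" by (simp add: P_def)
    have z0: "z \<noteq> 0" by (rule upper_half_plane_nonzero[OF z])
    define e where "e = hfun E2 z"
    define A B where "A = discr (- 1 / z)" and "B = discr z"
    have B0: "B \<noteq> 0" by (simp add: B_def)
    have "((\<lambda>z. discr (- 1 / z)) has_field_derivative
        P * (z\<^sup>2 * e + 12 * z / P) * A * (1 / z\<^sup>2)) (at z)"
      unfolding P_def e_def A_def hfun_E2_S[OF z, symmetric]
      by (rule DERIV_chain2[where g = "\<lambda>z. - 1 / z", OF discr_has_field_derivative[OF S_upper_half_plane(1)[OF z]]])
         (use z0 in \<open>auto intro!: derivative_eq_intros simp: power2_eq_square\<close>)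
    moreover have "P * (z\<^sup>2 * e + 12 * z / P) * A * (1 / z\<^sup>2) = (P * e + 12 / z) * A"
      using z0 P by (simp add: divide_simps power2_eq_square) (simp add: algebra_simps)
    ultimately have 1: "((\<lambda>z. discr (- 1 / z)) has_field_derivative (P * e + 12 / z) * A) (at z)"
      by simp
    have "((\<lambda>z. z ^ 12 * discr z) has_field_derivative
        12 * z ^ 11 * B + P * e * B * z ^ 12) (at z)"
      unfolding P_def e_def B_def
      by (rule derivative_eq_intros discr_has_field_derivative[OF z] refl)+ simp
    moreover have "12 * z ^ 11 * B + P * e * B * z ^ 12 = (P * e + 12 / z) * (z ^ 12 * B)"
    proof -
      have "z ^ 12 = z * z ^ 11" by (simp flip: power_Suc)
      then show ?thesis using z0 by (simp add: divide_simps) (simp add: algebra_simps)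
    qed
    ultimately have 2: "((\<lambda>z. z ^ 12 * discr z) has_field_derivative (P * e + 12 / z) * (z ^ 12 * B)) (at z)"
      by simp
    have "z ^ 12 * discr z \<noteq> 0" using z0 by simp
    from DERIV_divide[OF 1 2 this] show ?thesis
      by (simp add: A_def B_def algebra_simps)
  qed
  then have "\<exists>c. \<forall>z\<in>upper_half_plane. ?u z = c"
    by (intro has_field_derivative_zero_constant, unfold upper_half_plane_def)
       (rule convex_halfspace_Im_gt, blast intro: has_field_derivative_at_within)
  then obtain c where c: "\<And>z. z \<in> upper_half_plane \<Longrightarrow> ?u z = c" by blast
  have "\<i> ^ 12 = (\<i>\<^sup>2) ^ 6" unfolding power_mult[symmetric] by simp
  then have "\<i> ^ 12 = (1 :: complex)" by simp
  then have "c = 1" using c[of \<i>] by (simp add: upper_half_plane_def)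
  with c[OF assms] show ?thesis
    using upper_half_plane_nonzero[OF assms] by (simp add: field_simps)
qed

section \<open>Division by the discriminant and the vanishing of forms of negative weight\<close>

lemma holomorphic_imp_disc_fps:
  assumes "g holomorphic_on ball 0 1"
  shows "fps_expansion g 0 \<in> disc_fps"
    "\<And>q. norm q < 1 \<Longrightarrow> eval_fps (fps_expansion g 0) q = g q"
proof -
  have g: "g holomorphic_on eball 0 1" using assms by (simp add: one_ereal_def)
  show "fps_expansion g 0 \<in> disc_fps"
    using conv_radius_fps_expansion[OF g] by (simp add: disc_fps_def)
  show "eval_fps (fps_expansion g 0) q = g q" if "norm q < 1" for q
    using eval_fps_expansion'[OF g, of q] that by (simp add: one_ereal_def)
qed

text \<open>\<open>discr\<close> is the nome times a function of it without zeros on the disc.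
  Dividing by its \<open>n\<close>-th power thus removes \<open>n\<close> vanishing coefficients and
  keeps holomorphy at the cusp, while the weight drops by \<open>12 n\<close>.\<close>

lemma modular_fps_divide_discr:
  assumes A: "A \<in> modular_fps w" and n: "\<And>i. i < n \<Longrightarrow> fps_nth A i = 0"
  obtains C where "C \<in> modular_fps (w - 12 * int n)"
    "\<And>z. z \<in> upper_half_plane \<Longrightarrow> hfun A z = discr z ^ n * hfun C z"
proof -
  have disc: "A \<in> disc_fps" using A by (rule modular_fps_disc_fps)
  define B where "B = fps_shift n A"
  have Bd: "B \<in> disc_fps" using disc by (auto simp: B_def)
  have AB: "A = fps_X ^ n * B"
    by (rule fps_ext) (auto simp: B_def fps_X_power_mult_nth n)
  define g where "g q = exp (- of_nat n * eval_fps log_discr_fps q)" for q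
  have "ball 0 1 \<subseteq> eball (0::complex) (fps_conv_radius log_discr_fps)"
    using disc_fps_conv_radius[OF log_discr_disc_fps] by auto
  then have "g holomorphic_on ball 0 1"
    unfolding g_def by (intro holomorphic_intros holomorphic_on_eval_fps)
  note g = holomorphic_imp_disc_fps[OF this]
  define C where "C = B * fps_expansion g 0"
  have Cd: "C \<in> disc_fps" using Bd g(1) by (auto simp: C_def)
  have eq: "hfun A z = discr z ^ n * hfun C z" if z: "z \<in> upper_half_plane" for z
  proof -
    have q: "norm (nome z) < 1" using nome_in_disc[OF z] .
    have "hfun A z = nome z ^ n * eval_fps B (nome z)"
      using z q Bd by (simp add: AB hfun_def eval_fps_mult disc_fps_conv_radius)
    also have "\<dots> = discr z ^ n * (eval_fps B (nome z) * g (nome z))"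
      by (simp add: discr_def g_def power_mult_distrib exp_minus field_simps flip: exp_of_nat_mult)
    also have "eval_fps B (nome z) * g (nome z) = hfun C z"
      using z q Bd g by (simp add: C_def hfun_def eval_fps_mult disc_fps_conv_radius)
    finally show ?thesis .
  qed
  have "hfun C (- 1 / z) = z powi (w - 12 * int n) * hfun C z" if z: "z \<in> upper_half_plane" for z
  proof -
    have z0: "z \<noteq> 0" by (rule upper_half_plane_nonzero[OF z])
    have "discr (- 1 / z) ^ n * hfun C (- 1 / z) = z powi w * (discr z ^ n * hfun C z)"
      using A z eq[OF z] eq[OF S_upper_half_plane(1)[OF z]] by (simp add: modular_fps_def)
    then have "z ^ (12 * n) * hfun C (- 1 / z) = z powi w * hfun C z"
      unfolding discr_S[OF z] power_mult_distrib by (simp add: power_mult)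
    moreover have "z powi (w - 12 * int n) = z powi w / z ^ (12 * n)"
      using z0 power_int_diff[of z w "12 * int n"] power_int_of_nat[of z "12 * n"] by simp
    moreover have "z ^ (12 * n) \<noteq> 0" using z0 by simp
    ultimately show ?thesis by (metis nonzero_mult_div_cancel_left times_divide_eq_left)
  qed
  with Cd have "C \<in> modular_fps (w - 12 * int n)" by (simp add: modular_fps_def)
  with eq that show ?thesis by blast
qed

text \<open>
  If \<open>Im z < 1/2\<close>, moving \<open>z\<close> into the strip \<open>\<bar>Re z\<bar> \<le> 1/2\<close> and applying \<open>S\<close> at least doubles \<open>Im z\<close>.
\<close>

lemma upper_half_plane_invariant_bound:
  fixes \<phi> :: "complex \<Rightarrow> real"
  assumes T: "\<And>z k. \<phi> (z + of_int k) = \<phi> z"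
    and S: "\<And>z. z \<in> upper_half_plane \<Longrightarrow> \<phi> (- 1 / z) = \<phi> z"
    and M: "\<And>z. Im z \<ge> 1 / 2 \<Longrightarrow> \<phi> z \<le> M"
    and z: "z \<in> upper_half_plane"
  shows "\<phi> z \<le> M"
proof -
  have *: "Im z > 0 \<Longrightarrow> Im z \<ge> (1 / 2) ^ Suc n \<Longrightarrow> \<phi> z \<le> M" for n z
  proof (induction n arbitrary: z)
    case 0
    then show ?case using M[of z] by simp
  next
    case (Suc n)
    show ?case
    proof (cases "Im z \<ge> 1 / 2")
      case True
      then show ?thesis by (rule M)
    next
      case False
      define k where "k = - round (Re z)"
      define y where "y = z + of_int k"
      have Im: "Im y = Im z" by (simp add: y_def)
      have "\<bar>Re y\<bar> \<le> 1 / 2"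
        using of_int_round_abs_le[of "Re z"] by (simp add: y_def k_def abs_minus_commute)
      then have "(Re y)\<^sup>2 \<le> (1 / 2)\<^sup>2" by (rule power2_le_iff_abs_le[THEN iffD2, rotated]) simp
      moreover have "(Im y)\<^sup>2 < (1 / 2)\<^sup>2"
        using False Suc.prems Im by (intro power_strict_mono) auto
      ultimately have "(Re y)\<^sup>2 + (Im y)\<^sup>2 \<le> 1 / 2" by (simp add: power2_eq_square)
      moreover have pos: "(Re y)\<^sup>2 + (Im y)\<^sup>2 > 0" using Suc.prems Im
        by (intro add_nonneg_pos) auto
      ultimately have "Im z / (1 / 2) \<le> Im z / ((Re y)\<^sup>2 + (Im y)\<^sup>2)"
        using Suc.prems by (intro divide_left_mono) auto
      also have "\<dots> = Im (- 1 / y)" by (simp add: Im_divide Im)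
      finally have "Im (- 1 / y) \<ge> 2 * Im z" by simp
      then have "\<phi> (- 1 / y) \<le> M" using Suc.prems by (intro Suc.IH) auto
      also have "\<phi> (- 1 / y) = \<phi> y" using Suc.prems Im
        by (intro S) (simp add: upper_half_plane_def)
      also have "\<phi> y = \<phi> z" by (simp add: y_def T)
      finally show ?thesis .
    qed
  qed
  have "Im z > 0" using z by (simp add: upper_half_plane_def)
  then obtain n where "(1 / 2) ^ n < Im z" using real_arch_pow_inv[of "Im z" "1 / 2"] by auto
  moreover have "(1 / 2 :: real) ^ Suc n \<le> (1 / 2) ^ n" by simp
  ultimately show ?thesis using *[of z n] \<open>Im z > 0\<close> by linarith
qed

lemma norm_nome: "norm (nome z) = exp (- 2 * pi * Im z)"
  by (simp add: nome_def)

text \<open>\<open>\<phi>\<close> is the invariant norm \<open>|A| y^(w/2)\<close>, where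
  \<open>y = Im z\<close> and \<open>s = - w / 2 > 0\<close>. It is bounded near the cusp because
  \<open>y^(- s)\<close> decreases, hence everywhere. So \<open>|A| <= M y^s\<close>, which tends to
  0 as \<open>|q|\<close> tends to 1, and the maximum principle on discs of radius
  \<open>r < 1\<close> gives \<open>A = 0\<close>.\<close>

lemma modular_fps_negative_weight:
  assumes A: "A \<in> modular_fps w" and w: "w < 0"
  shows "A = 0"
proof -
  have disc: "A \<in> disc_fps" using A by (rule modular_fps_disc_fps)
  define s where "s = - real_of_int w / 2"
  have s: "s > 0" using w by (simp add: s_def)
  define \<phi> where "\<phi> z = norm (hfun A z) * Im z powr - s" for z
  have cont: "continuous_on (cball 0 r) (eval_fps A)" if "r < 1" for r
    by (intro continuous_on_eval_fps' continuous_on_id) (use that disc_fps_conv_radius[OF disc] in auto)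
  \<comment> \<open>\<open>exp (- pi)\<close> is the norm of the nome on the line
    \<open>Im z = 1/2\<close>.\<close>
  have "compact (eval_fps A ` cball 0 (exp (- pi)))"
    by (intro compact_continuous_image cont) auto
  then obtain K where K: "\<And>q. norm q \<le> exp (- pi) \<Longrightarrow> norm (eval_fps A q) \<le> K"
    unfolding compact_eq_bounded_closed bounded_iff by (metis imageI mem_cball_0)
  have K0: "K \<ge> 0" using order_trans[OF norm_ge_zero K[of 0]] by simp
  define M where "M = K * (1 / 2) powr - s"
  have M: "\<phi> z \<le> M" if "z \<in> upper_half_plane" for z
  proof (rule upper_half_plane_invariant_bound[OF _ _ _ that])
    show "\<phi> (z + of_int k) = \<phi> z" for z k by (simp add: \<phi>_def hfun_plus_of_int)
    show "\<phi> (- 1 / z) = \<phi> z" if z: "z \<in> upper_half_plane" for z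
    proof -
      have z0: "norm z > 0" using upper_half_plane_nonzero[OF z] by simp
      have y: "Im z > 0" using z by (simp add: upper_half_plane_def)
      have im: "Im (- 1 / z) = Im z / (norm z)\<^sup>2" by (simp add: Im_divide cmod_power2)
      have "norm (hfun A (- 1 / z)) = norm z powi w * norm (hfun A z)"
        using A z by (simp add: modular_fps_def norm_mult norm_power_int)
      also have "norm z powi w = norm z powr (- 2 * s)"
        using z0 by (simp add: s_def powr_real_of_int')
      finally have "\<phi> (- 1 / z) = norm z powr (- 2 * s) * norm (hfun A z) *
          (Im z powr - s / ((norm z)\<^sup>2) powr - s)"
        unfolding \<phi>_def im using y z0 by (simp add: powr_divide)
      also have "((norm z)\<^sup>2) powr - s = norm z powr (- 2 * s)"
        using z0 by (simp add: powr_powr flip: powr_numeral)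
      finally show ?thesis using z0 by (simp add: \<phi>_def)
    qed
    show "\<phi> z \<le> M" if z: "Im z \<ge> 1 / 2" for z
    proof -
      have "norm (nome z) \<le> exp (- pi)"
        using z pi_gt_zero by (simp add: norm_nome)
      then have "norm (hfun A z) \<le> K" using K K0 by (simp add: hfun_def)
      moreover have "Im z powr - s \<le> (1 / 2) powr - s"
        using z s by (intro powr_mono2') auto
      ultimately show ?thesis unfolding \<phi>_def M_def using K0 by (intro mult_mono) auto
    qed
  qed
  have "eval_fps A q0 = 0" if q0: "norm q0 < 1" for q0
  proof -
    have bound: "norm (eval_fps A q0) \<le> M * (- ln r / (2 * pi)) powr s" if r: "norm q0 < r" "r < 1" for r
    proof (rule maximum_modulus_frontier[of "eval_fps A" "cball 0 r"])
      have r0: "r > 0" using r by (meson norm_ge_zero le_less_trans)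
      show "eval_fps A holomorphic_on interior (cball 0 r)"
        using disc_fps_conv_radius[OF disc] r
        by (intro holomorphic_on_eval_fps) (auto simp: subset_iff)
      show "continuous_on (closure (cball 0 r)) (eval_fps A)" using cont r by simp
      fix q :: complex assume "q \<in> frontier (cball 0 r)"
      then have q: "norm q = r" using r0 by (simp add: frontier_cball)
      then obtain z where z: "z \<in> upper_half_plane" "nome z = q"
        using nome_surj[of q] r r0 by auto
      have "ln r = - 2 * pi * Im z" using z q norm_nome[of z] by simp
      then have im: "Im z = - ln r / (2 * pi)" by (simp add: field_simps)
      have y: "Im z > 0" using z by (simp add: upper_half_plane_def)
      have "norm (hfun A z) * (Im z powr - s * Im z powr s) \<le> M * Im z powr s"
        using M[OF z(1)] unfolding \<phi>_def mult.assoc[symmetric] by (intro mult_right_mono) auto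
      then show "norm (eval_fps A q) \<le> M * (- ln r / (2 * pi)) powr s"
        using y z unfolding powr_add[symmetric] im[symmetric] by (simp add: hfun_def)
    qed (use r in auto)
    have "((\<lambda>r. M * (- ln r / (2 * pi)) powr s) \<longlongrightarrow> M * (- ln 1 / (2 * pi)) powr s) (at_left 1)"
      using s
      by (intro tendsto_intros) (auto simp: eventually_at_left_field divide_le_0_iff intro!: exI[of _ 0])
    moreover have "eventually (\<lambda>r. norm (eval_fps A q0) \<le> M * (- ln r / (2 * pi)) powr s) (at_left 1)"
      using bound q0 by (auto simp: eventually_at_left_field intro!: exI[of _ "norm q0"])
    ultimately have "norm (eval_fps A q0) \<le> M * (- ln 1 / (2 * pi)) powr s"
      by (rule tendsto_lowerbound) (simp add: trivial_limit_at_left_real)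
    then show ?thesis by simp
  qed
  then show ?thesis
    by (intro hfun_eqI disc) (auto simp: hfun_def nome_in_disc)
qed

text \<open>Division by \<open>discr ^ n\<close> produces a form of negative weight.\<close>

theorem modular_fps_valence:
  assumes A: "A \<in> modular_fps w" and w: "w < 12 * int n" and n: "\<And>i. i < n \<Longrightarrow> fps_nth A i = 0"
  shows "A = 0"
proof -
  from modular_fps_divide_discr[OF A n] obtain C where C: "C \<in> modular_fps (w - 12 * int n)"
    "\<And>z. z \<in> upper_half_plane \<Longrightarrow> hfun A z = discr z ^ n * hfun C z" by blast
  from modular_fps_negative_weight[OF C(1)] w have "C = 0" by simp
  with C(2) show ?thesis
    by (intro hfun_eqI modular_fps_disc_fps[OF A]) (auto simp: hfun_simps)
qed

section \<open>Extremal quasimodular forms\<close>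

definition qD :: "complex fps \<Rightarrow> complex fps" where
  "qD A = fps_X * fps_deriv A"

lemma qD_nth [simp]: "fps_nth (qD A) n = of_nat n * fps_nth A n"
  by (cases n) (auto simp: qD_def fps_X_mult_nth)

lemma qD_simps:
  "qD (A + B) = qD A + qD B" "qD (A - B) = qD A - qD B"
  "qD (A * B) = qD A * B + A * qD B" "qD (fps_const c * A) = fps_const c * qD A"
  "qD (of_int n * A) = of_int n * qD A" "qD (numeral k * A) = numeral k * qD A" "qD 1 = 0"
proof -
  show "qD (A + B) = qD A + qD B" "qD (A - B) = qD A - qD B" "qD (A * B) = qD A * B + A * qD B"
    by (simp_all add: qD_def algebra_simps)
  show "qD (fps_const c * A) = fps_const c * qD A" for c
    by (rule fps_ext) simp
  from this[of "of_int n"] this[of "numeral k"]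
  show "qD (of_int n * A) = of_int n * qD A" "qD (numeral k * A) = numeral k * qD A"
    by (simp_all flip: fps_of_int fps_numeral_fps_const)
  show "qD 1 = 0" by (simp add: qD_def)
qed

lemma fps_mult_nth_lowest:
  fixes A B :: "complex fps"
  assumes "\<And>i. i < m \<Longrightarrow> fps_nth A i = 0" "\<And>i. i < n \<Longrightarrow> fps_nth B i = 0"
  shows "fps_nth (A * B) (m + n) = fps_nth A m * fps_nth B n"
    and "\<And>i. i < m + n \<Longrightarrow> fps_nth (A * B) i = 0"
proof -
  have "A = fps_X ^ m * fps_shift m A" "B = fps_X ^ n * fps_shift n B"
    by (rule fps_ext, use assms in \<open>simp add: fps_X_power_mult_nth\<close>)+
  then have "A * B = fps_X ^ (m + n) * (fps_shift m A * fps_shift n B)"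
    by (metis (no_types, lifting) mult.assoc mult.left_commute power_add)
  then show "fps_nth (A * B) (m + n) = fps_nth A m * fps_nth B n"
    "\<And>i. i < m + n \<Longrightarrow> fps_nth (A * B) i = 0"
    by (simp_all add: fps_X_power_mult_nth)
qed

lemma fps_mult_nth_order:
  fixes A B :: "complex fps"
  assumes "\<And>i. i < n \<Longrightarrow> fps_nth A i = 0"
  shows "fps_nth (B * A) n = fps_nth B 0 * fps_nth A n"
    and "\<And>i. i < n \<Longrightarrow> fps_nth (B * A) i = 0"
  using fps_mult_nth_lowest[of 0 B n A] assms by auto

lemma Eisenstein_nth_0 [simp]: "fps_nth E2 0 = 1" "fps_nth E4 0 = 1" "fps_nth E6 0 = 1"
  by (simp_all add: E2_def E4_def E6_def)

lemma E4_eq: "E4 = E2 * E2 - 12 * qD E2"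
  by (simp add: E4_def qD_def numeral_fps_const)

lemma E6_eq: "E6 = E2 * E4 - 3 * qD E4"
  by (simp add: E6_def qD_def numeral_fps_const)

lemma Eisenstein_nth_1:
  "fps_nth E2 1 = - 24" "fps_nth E4 1 = 240" "fps_nth E6 1 = - 504"
proof -
  show 2: "fps_nth E2 1 = - 24" by (simp add: E2_def divisor_sum_def)
  show 4: "fps_nth E4 1 = 240" using 2 by (simp add: E4_eq fps_mult_nth)
  show "fps_nth E6 1 = - 504" using 2 4 by (simp add: E6_eq fps_mult_nth)
qed

text \<open>12 times the Serre derivative, which keeps denominators out of the ring identities and
  of the integrality argument.\<close>

definition serre12 :: "int \<Rightarrow> complex fps \<Rightarrow> complex fps" where
  "serre12 w A = 12 * qD A - of_int w * E2 * A"

lemma serre12_modular_fps: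
  assumes "A \<in> modular_fps w"
  shows "serre12 w A \<in> modular_fps (w + 2)"
proof -
  have c: "fps_const 12 * (fps_const (of_int w / 12) * B) = of_int w * B" for B :: "complex fps"
    unfolding mult.assoc[symmetric] fps_const_mult by (simp add: fps_of_int)
  have "serre12 w A = fps_const 12 * serre_deriv w A"
    unfolding serre12_def serre_deriv_def qD_def right_diff_distrib mult.assoc c
    by (simp add: numeral_fps_const)
  then show ?thesis using modular_fps_const_mult[OF serre_deriv_modular_fps[OF assms]] by simp
qed

lemma ramanujan_E2: "12 * qD E2 = E2 * E2 - E4"
  by (simp add: E4_eq)

lemma ramanujan_E4: "3 * qD E4 = E2 * E4 - E6"
  by (simp add: E6_eq)

text \<open>The defect is a modular form of weight 8 with vanishing constant term, and 8 is below
  12.\<close>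

lemma ramanujan_E6: "2 * qD E6 = E2 * E6 - E4 * E4"
proof -
  have "serre12 6 E6 + fps_const 6 * (E4 * E4) \<in> modular_fps 8"
    using serre12_modular_fps[OF E6_modular_fps]
    by (intro modular_fps_add modular_fps_const_mult modular_fps_mult[OF E4_modular_fps E4_modular_fps]) auto
  then have "serre12 6 E6 + fps_const 6 * (E4 * E4) = 0"
    by (rule modular_fps_valence[where n = 1]) (auto simp: serre12_def)
  then have "12 * qD E6 = 6 * (E2 * E6 - E4 * E4)"
    by (simp add: serre12_def numeral_fps_const algebra_simps)
  then show ?thesis by algebra
qed

section \<open>Quasimodular forms of depth at most 1 and their order at the cusp\<close>

definition quasimodular_fps :: "int \<Rightarrow> complex fps set" where
  "quasimodular_fps w = {f0 + f1 * E2 | f0 f1. f0 \<in> modular_fps w \<and> f1 \<in> modular_fps (w - 2)}"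

lemma quasimodular_fps_disc_fps: "A \<in> quasimodular_fps w \<Longrightarrow> A \<in> disc_fps"
  by (auto simp: quasimodular_fps_def dest: modular_fps_disc_fps)

lemma quasimodular_fps_diff: "A \<in> quasimodular_fps w \<Longrightarrow> B \<in> quasimodular_fps w \<Longrightarrow> A - B \<in> quasimodular_fps w"
proof -
  assume "A \<in> quasimodular_fps w" "B \<in> quasimodular_fps w"
  then obtain a0 a1 b0 b1 where "A = a0 + a1 * E2" "B = b0 + b1 * E2"
    "a0 \<in> modular_fps w" "b0 \<in> modular_fps w" "a1 \<in> modular_fps (w - 2)" "b1 \<in> modular_fps (w - 2)"
      by (auto simp: quasimodular_fps_def)
  moreover from this have "A - B = (a0 - b0) + (a1 - b1) * E2" by (simp add: algebra_simps)
  ultimately show ?thesis unfolding quasimodular_fps_def using modular_fps_diff by blast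
qed

lemma quasimodular_fps_mult:
  assumes "B \<in> modular_fps v" "A \<in> quasimodular_fps w" "v + w = u"
  shows "B * A \<in> quasimodular_fps u"
proof -
  obtain a0 a1 where a: "A = a0 + a1 * E2" "a0 \<in> modular_fps w" "a1 \<in> modular_fps (w - 2)"
    using assms by (auto simp: quasimodular_fps_def)
  have "B * a0 \<in> modular_fps u" "B * a1 \<in> modular_fps (u - 2)"
    using assms a by (auto intro: modular_fps_mult)
  moreover have "B * A = B * a0 + B * a1 * E2" by (simp add: a algebra_simps)
  ultimately show ?thesis unfolding quasimodular_fps_def by blast
qed

lemma quasimodular_fps_const_mult: "A \<in> quasimodular_fps w \<Longrightarrow> fps_const c * A \<in> quasimodular_fps w"
  using quasimodular_fps_mult[OF modular_fps_const_mult[OF modular_fps_1]]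
  by (metis add_0 mult.right_neutral)

text \<open>
  A quasimodular form of weight \<open>w\<close> and depth 1 spans with its modular completion a
  vector-valued form of weight \<open>w - 1\<close>; hence the shift in the Serre derivative.
\<close>

lemma serre12_quasimodular_fps:
  assumes "A \<in> quasimodular_fps w"
  shows "serre12 (w - 1) A \<in> quasimodular_fps (w + 2)"
proof -
  obtain a0 a1 where a: "A = a0 + a1 * E2" "a0 \<in> modular_fps w" "a1 \<in> modular_fps (w - 2)"
    using assms by (auto simp: quasimodular_fps_def)
  \<comment> \<open>With the shift \<open>w - 1\<close>, the term \<open>E2 * E2\<close> coming from
    \<open>12 * qD E2\<close> is exactly what completes \<open>serre12 (w - 2) a1 * E2\<close>, so
    the depth does not grow.\<close>
  have "serre12 (w - 1) A = (serre12 w a0 - E4 * a1) + (serre12 (w - 2) a1 + a0) * E2"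
    unfolding serre12_def a(1) qD_simps(1,3) of_int_diff of_int_numeral of_int_1
    using ramanujan_E2 by algebra
  moreover have "serre12 w a0 - E4 * a1 \<in> modular_fps (w + 2)"
    using a
    by (intro modular_fps_diff serre12_modular_fps modular_fps_mult[OF E4_modular_fps]) auto
  moreover have "serre12 (w - 2) a1 + a0 \<in> modular_fps (w + 2 - 2)"
    using a serre12_modular_fps[OF a(3)] by (intro modular_fps_add) auto
  ultimately show ?thesis unfolding quasimodular_fps_def by blast
qed

text \<open>The weight \<open>12 k + 8\<close> of \<open>\<Phi>\<close> lies below
  \<open>12 (k + 1)\<close>, which forces \<open>\<Phi> = 0\<close>. If \<open>f1\<close> and
  \<open>A\<close> have orders \<open>u\<close> and \<open>v\<close>, the coefficient of this
  relation at \<open>q^(u + v)\<close> is \<open>12 (u - v)\<close> times the product of their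
  lowest coefficients, and \<open>u <= k < v\<close> makes it nonzero; \<open>A * A\<close> starts
  only at \<open>q^(2 v)\<close>.\<close>

theorem quasimodular_fps_valence:
  assumes A: "A \<in> quasimodular_fps (6 * int k + 4)" and ord: "\<And>i. i \<le> k \<Longrightarrow> fps_nth A i = 0"
  shows "A = 0"
proof (rule ccontr)
  assume A0: "A \<noteq> 0"
  define w where "w = 6 * int k + 4"
  obtain f0 f1 where f: "A = f0 + f1 * E2" "f0 \<in> modular_fps w" "f1 \<in> modular_fps (w - 2)"
    using A by (auto simp: quasimodular_fps_def w_def)
  define \<Phi> where "\<Phi> = f0 * serre12 (w - 2) f1 - f1 * serre12 w f0 + (f0 * f0 + E4 * (f1 * f1))"
  have \<Phi>: "\<Phi> \<in> modular_fps (2 * w)"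
    unfolding \<Phi>_def
    by (intro modular_fps_add modular_fps_diff modular_fps_mult[OF f(2) serre12_modular_fps[OF f(3)]]
          modular_fps_mult[OF f(3) serre12_modular_fps[OF f(2)]]
          modular_fps_mult[OF f(2) f(2)] modular_fps_mult[OF E4_modular_fps modular_fps_mult[OF f(3) f(3) refl]]) auto
  \<comment> \<open>the Wronskian of the two components of the vector-valued form attached to \<open>A\<close>\<close>
  have eq: "\<Phi> = A * A + 12 * (A * qD f1 - f1 * qD A)"
    unfolding \<Phi>_def serre12_def f(1) qD_simps(1,3) of_int_diff of_int_numeral using ramanujan_E2 by algebra
  have "fps_nth \<Phi> i = 0" if "i < Suc k" for i
  proof -
    have "fps_nth (B * A) i = 0" "fps_nth (B * qD A) i = 0" for B
      using that ord by (auto intro!: fps_mult_nth_order(2)[of "Suc k"])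
    then show ?thesis unfolding eq by (simp add: mult.commute[of A "qD f1"])
  qed
  moreover have "2 * w < 12 * int (Suc k)" by (simp add: w_def)
  ultimately have "\<Phi> = 0" using modular_fps_valence[OF \<Phi>, of "Suc k"] by blast
  with eq have 0: "A * A + 12 * (A * qD f1 - f1 * qD A) = 0" by simp
  show False
  proof (cases "f1 = 0")
    case True
    with 0 A0 show False by (simp add: qD_def)
  next
    case False
    define u v where "u = subdegree f1" and "v = subdegree A"
    have u: "\<And>i. i < u \<Longrightarrow> fps_nth f1 i = 0" "fps_nth f1 u \<noteq> 0"
      using False by (auto simp: u_def)
    have v: "\<And>i. i < v \<Longrightarrow> fps_nth A i = 0" "fps_nth A v \<noteq> 0"
      using A0 by (auto simp: v_def)
    have "u \<le> k"
    proof (rule ccontr)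
      assume "\<not> u \<le> k"
      then have "f1 = 0"
        by (intro modular_fps_valence[OF f(3), where n = "Suc k"] u(1)) (auto simp: w_def)
      with False show False ..
    qed
    moreover have "v > k" using ord v(2) by (metis not_le)
    ultimately have uv: "u < v" by simp
    have 1: "fps_nth (A * A) (v + u) = 0"
      by (rule fps_mult_nth_lowest(2)[of v A v A]) (use v uv in auto)
    have 2: "fps_nth (A * qD f1) (v + u) = fps_nth A v * (of_nat u * fps_nth f1 u)"
      using fps_mult_nth_lowest(1)[of v A u "qD f1"] v u by simp
    have 3: "fps_nth (f1 * qD A) (v + u) = fps_nth f1 u * (of_nat v * fps_nth A v)"
      using fps_mult_nth_lowest(1)[of u f1 v "qD A"] v u by (simp add: add.commute)
    have "fps_nth (A * A + 12 * (A * qD f1 - f1 * qD A)) (v + u) = 0" unfolding 0 by simp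
    then have "12 * (fps_nth A v * (of_nat u * fps_nth f1 u) - fps_nth f1 u * (of_nat v * fps_nth A v)) = 0"
      by (simp only: fps_add_nth fps_sub_nth fps_mult_numeral_left 1 2 3 add_0)
    then have "12 * (fps_nth A v * fps_nth f1 u * (of_nat u - of_nat v)) = 0"
      by (simp only: right_diff_distrib mult_ac)
    then show False using u v uv by simp
  qed
qed

text \<open>The recursion for \<open>w = 6 k\<close>, written with \<open>serre12\<close>; the
  factor 12 in that operator turns the constant \<open>(w + 6) / (72 (w + 1) (w + 5))\<close> into
  the one used here.\<close>

fun extremal_fps :: "nat \<Rightarrow> complex fps" where
  "extremal_fps 0 = 1"
| "extremal_fps (Suc k) = fps_const (of_nat (Suc k) / (144 * of_nat (6 * k + 1) * of_nat (6 * k + 5))) *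
     (E4 * serre12 (6 * int k - 1) (extremal_fps k) - of_nat (6 * k + 1) * (E6 * extremal_fps k))"

lemma extremal_fps_quasimodular_fps: "extremal_fps k \<in> quasimodular_fps (6 * int k)"
proof (induction k)
  case 0
  have "1 = 1 + 0 * E2" by simp
  then have "1 \<in> quasimodular_fps 0" unfolding quasimodular_fps_def using modular_fps_1 modular_fps_0 by blast
  then show ?case by simp
next
  case (Suc k)
  have 1: "E4 * serre12 (6 * int k - 1) (extremal_fps k) \<in> quasimodular_fps (6 * int (Suc k))"
    by (rule quasimodular_fps_mult[OF E4_modular_fps serre12_quasimodular_fps[OF Suc]]) simp
  have "fps_const (of_nat (6 * k + 1)) * (E6 * extremal_fps k) \<in> quasimodular_fps (6 * int (Suc k))"
    by (intro quasimodular_fps_const_mult quasimodular_fps_mult[OF E6_modular_fps Suc]) simp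
  then have 2: "of_nat (6 * k + 1) * (E6 * extremal_fps k) \<in> quasimodular_fps (6 * int (Suc k))"
    by (simp only: fps_of_nat)
  show ?case unfolding extremal_fps.simps
    by (intro quasimodular_fps_const_mult quasimodular_fps_diff 1 2)
qed

text \<open>Ramanujan's formulas and the equation for \<open>F\<close> express all derivatives
  through \<open>E2\<close>, \<open>E4\<close>, \<open>E6\<close>, \<open>F\<close> and
  \<open>A = serre12 (w - 1) F\<close>, and the terms with \<open>E2\<close> cancel by weight. With
  \<open>H\<close> as in the proof, \<open>serre12 (w + 5) G = (w + 5) H\<close> and
  \<open>serre12 (w + 7) H = (w + 7) E4 G\<close>; the product \<open>(w + 5) (w + 7)\<close> is
  \<open>(w + 6)^2 - 1\<close>.\<close>

lemma extremal_step:
  fixes w :: int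
  assumes ode: "serre12 (w + 1) (serre12 (w - 1) F) = of_int (w\<^sup>2 - 1) * (E4 * F)"
    and G: "G = E4 * serre12 (w - 1) F - of_int (w + 1) * (E6 * F)"
  shows "serre12 (w + 5) G = of_int (w + 5) * (of_int (w + 1) * (E4 * E4 * F) - E6 * serre12 (w - 1) F)"
    and "serre12 (w + 7) (serre12 (w + 5) G) = of_int ((w + 6)\<^sup>2 - 1) * (E4 * G)"
proof -
  define A where "A = serre12 (w - 1) F"
  define W :: "complex fps" where "W = of_int w"
  have ci: "of_int (w - 1) = W - 1" "of_int (w + 1) = W + 1" "of_int (w + 5) = W + 5"
    "of_int (w + 7) = W + 7" "of_int (w\<^sup>2 - 1) = W\<^sup>2 - 1" "of_int ((w + 6)\<^sup>2 - 1) = (W + 6)\<^sup>2 - 1"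
    by (simp_all add: W_def)
  have qW: "qD ((W + 1) * B) = (W + 1) * qD B" "qD ((W + 5) * B) = (W + 5) * qD B" for B
    using qD_simps(5)[of "w + 1" B] qD_simps(5)[of "w + 5" B] by (simp_all only: ci)
  have dF: "12 * qD F = A + (W - 1) * E2 * F"
    unfolding A_def serre12_def ci by simp
  have dA: "12 * qD A = (W\<^sup>2 - 1) * (E4 * F) + (W + 1) * E2 * A"
    using ode unfolding A_def[symmetric] unfolding serre12_def ci by (simp add: algebra_simps)
  have G': "G = E4 * A - (W + 1) * (E6 * F)" unfolding G A_def ci ..
  have d4: "12 * qD E4 = 4 * (E2 * E4 - E6)" and d6: "12 * qD E6 = 6 * (E2 * E6 - E4 * E4)"
    by (simp_all flip: ramanujan_E4 ramanujan_E6)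
  have "12 * qD G = (12 * qD E4) * A + E4 * (12 * qD A) - (W + 1) * ((12 * qD E6) * F + E6 * (12 * qD F))"
    unfolding G' qD_simps(2) qW unfolding qD_simps(3) by (simp add: algebra_simps)
  then have 1: "serre12 (w + 5) G = (W + 5) * ((W + 1) * (E4 * E4 * F) - E6 * A)"
    unfolding d4 d6 dF dA serre12_def ci G' by (simp add: algebra_simps power2_eq_square)
  then show "serre12 (w + 5) G = of_int (w + 5) * (of_int (w + 1) * (E4 * E4 * F) - E6 * serre12 (w - 1) F)"
    by (simp only: ci A_def)
  define H where "H = (W + 1) * (E4 * E4 * F) - E6 * A"
  have "12 * qD H = (W + 1) * (2 * ((12 * qD E4) * E4 * F) + E4 * E4 * (12 * qD F))
           - ((12 * qD E6) * A + E6 * (12 * qD A))"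
    unfolding H_def qD_simps(2) qW unfolding qD_simps(3) by (simp add: algebra_simps)
  then have "12 * qD H - (W + 7) * E2 * H = (W + 7) * (E4 * G)"
    unfolding d4 d6 dF dA H_def G' by (simp add: algebra_simps power2_eq_square)
  then have "(W + 5) * (12 * qD H - (W + 7) * E2 * H) = (W + 5) * ((W + 7) * (E4 * G))" by simp
  then show "serre12 (w + 7) (serre12 (w + 5) G) = of_int ((w + 6)\<^sup>2 - 1) * (E4 * G)"
    unfolding 1 H_def[symmetric] unfolding serre12_def ci qW
    by (simp add: algebra_simps power2_eq_square)
qed

lemma serre12_const_mult: "serre12 w (fps_const c * A) = fps_const c * serre12 w A"
  unfolding serre12_def qD_simps(4) by (simp add: algebra_simps)

lemma extremal_fps_ode:
  "serre12 (6 * int k + 1) (serre12 (6 * int k - 1) (extremal_fps k)) =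
     of_int ((6 * int k)\<^sup>2 - 1) * (E4 * extremal_fps k)"
proof (induction k)
  case 0
  \<comment> \<open>The inner derivative of 1 is \<open>E2\<close>, and the outer one then gives
    \<open>12 * qD E2 - E2 * E2\<close>.\<close>
  have "serre12 1 (serre12 (- 1) 1) = - E4"
    using ramanujan_E2 by (simp add: serre12_def qD_simps algebra_simps)
  then show ?case by simp
next
  case (Suc k)
  define G where "G = E4 * serre12 (6 * int k - 1) (extremal_fps k) - of_int (6 * int k + 1) * (E6 * extremal_fps k)"
  define c :: complex where "c = of_nat (Suc k) / (144 * of_nat (6 * k + 1) * of_nat (6 * k + 5))"
  have F: "extremal_fps (Suc k) = fps_const c * G"
    by (simp add: c_def G_def)
  have i: "6 * int (Suc k) + 1 = 6 * int k + 7" "6 * int (Suc k) - 1 = 6 * int k + 5"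
    "6 * int (Suc k) = 6 * int k + 6" by simp_all
  have "serre12 (6 * int k + 7) (serre12 (6 * int k + 5) (fps_const c * G)) =
          of_int ((6 * int k + 6)\<^sup>2 - 1) * (E4 * (fps_const c * G))"
    unfolding serre12_const_mult extremal_step(2)[OF Suc G_def] by (simp only: mult_ac)
  then show ?case unfolding F i(1,2) unfolding i(3) .
qed

text \<open>At \<open>q^k\<close> the two terms of \<open>G\<close> cancel because
  \<open>12 k - (6 k - 1) = 6 k + 1\<close>. The recursion alone would need further coefficients of
  \<open>F\<close> to give the next one; instead, \<open>extremal_step\<close> relates
  \<open>G\<close> and its derivative to \<open>\<Delta> * F\<close>, whose lowest coefficient is
  known.\<close>

lemma extremal_fps_nth:
  "(\<forall>i<k. fps_nth (extremal_fps k) i = 0) \<and> fps_nth (extremal_fps k) k = 1"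
proof (induction k)
  case (Suc k)
  define F where "F = extremal_fps k"
  define G where "G = E4 * serre12 (6 * int k - 1) F - of_int (6 * int k + 1) * (E6 * F)"
  define c :: complex where "c = of_nat (Suc k) / (144 * of_nat (6 * k + 1) * of_nat (6 * k + 5))"
  have FS: "extremal_fps (Suc k) = fps_const c * G"
    by (simp add: c_def G_def F_def)
  have F: "\<And>i. i < k \<Longrightarrow> fps_nth F i = 0" "fps_nth F k = 1" using Suc by (auto simp: F_def)
  have of_int_nth: "fps_nth (of_int n * B) i = of_int n * fps_nth B i" for n B i
    by (simp flip: fps_of_int)
  have serre: "fps_nth (serre12 w B) i = 12 * (of_nat i * fps_nth B i) - of_int w * fps_nth (E2 * B) i" for w B i
    unfolding serre12_def mult.assoc by (simp add: of_int_nth)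
  have serre_nth: "fps_nth (serre12 w B) n = (12 * of_nat n - of_int w) * fps_nth B n"
    and serre_nth0: "\<And>i. i < n \<Longrightarrow> fps_nth (serre12 w B) i = 0"
    if "\<And>i. i < n \<Longrightarrow> fps_nth B i = 0" for w n B
    using fps_mult_nth_order[where B = E2, OF that] that
    unfolding serre by (simp_all add: algebra_simps)
  have A: "\<And>i. i < k \<Longrightarrow> fps_nth (serre12 (6 * int k - 1) F) i = 0"
    "fps_nth (serre12 (6 * int k - 1) F) k = of_nat (6 * k + 1)"
    using F(2) by (simp_all add: serre_nth0[of k F, OF F(1)] serre_nth[of k F, OF F(1)])
  have G_nth: "fps_nth G i = fps_nth (E4 * serre12 (6 * int k - 1) F) i - of_int (6 * int k + 1) * fps_nth (E6 * F) i" for i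
    unfolding G_def by (simp only: fps_sub_nth of_int_nth)
  have G0: "fps_nth G i = 0" if "i < Suc k" for i
  proof (cases "i = k")
    case True
    then show ?thesis
      using A F by (simp add: G_nth fps_mult_nth_order(1)[OF A(1)] fps_mult_nth_order(1)[OF F(1)])
  next
    case False
    then have "i < k" using that by simp
    then show ?thesis
      by (simp add: G_nth fps_mult_nth_order(2)[OF A(1)] fps_mult_nth_order(2)[OF F(1)])
  qed
  define g where "g = fps_nth G (Suc k)"
  define \<Delta> where "\<Delta> = E4 * E4 * E4 - E6 * E6"
  have \<Delta>: "fps_nth \<Delta> 0 = 0" "fps_nth \<Delta> 1 = 1728"
    by (simp_all add: \<Delta>_def fps_mult_nth Eisenstein_nth_1[unfolded One_nat_def])
  define W :: "complex fps" where "W = of_int (6 * int k)"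
  have "serre12 (6 * int k + 5) G = (W + 5) * ((W + 1) * (E4 * E4 * F) - E6 * serre12 (6 * int k - 1) F)"
    using extremal_step(1)[OF extremal_fps_ode[of k, folded F_def] G_def] by (simp add: W_def)
  moreover have "G = E4 * serre12 (6 * int k - 1) F - (W + 1) * (E6 * F)"
    by (simp add: G_def W_def)
  \<comment> \<open>The combination eliminates the derivative of \<open>F\<close>. Since
    \<open>G\<close> starts at \<open>q^(k+1)\<close>, the left side has there the coefficient
    \<open>g\<close> times \<open>(6 k + 5) + (12 (k + 1) - (6 k + 5)) = 12 (k + 1)\<close>.\<close>
  ultimately have "(W + 5) * (E6 * G) + E4 * serre12 (6 * int k + 5) G = (W + 5) * ((W + 1) * (\<Delta> * F))"
    unfolding \<Delta>_def by algebra
  then have "of_int (6 * int k + 5) * (E6 * G) + E4 * serre12 (6 * int k + 5) G =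
               of_int (6 * int k + 5) * (of_int (6 * int k + 1) * (\<Delta> * F))"
    by (simp add: W_def)
  from arg_cong[OF this, of "\<lambda>A. fps_nth A (Suc k)"]
  have "of_int (6 * int k + 5) * fps_nth (E6 * G) (Suc k) + fps_nth (E4 * serre12 (6 * int k + 5) G) (Suc k)
      = of_int (6 * int k + 5) * (of_int (6 * int k + 1) * fps_nth (\<Delta> * F) (Suc k))"
    by (simp only: fps_add_nth of_int_nth)
  moreover have "fps_nth (E6 * G) (Suc k) = g"
    using fps_mult_nth_order(1)[of "Suc k" G E6, OF G0] by (simp add: g_def)
  moreover have "fps_nth (E4 * serre12 (6 * int k + 5) G) (Suc k) = (12 * of_nat (Suc k) - of_int (6 * int k + 5)) * g"
    using fps_mult_nth_order(1)[of "Suc k" "serre12 (6 * int k + 5) G" E4, OF serre_nth0[of "Suc k" G, OF G0]]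
      serre_nth[of "Suc k" G, OF G0] by (simp add: g_def)
  moreover have "fps_nth (\<Delta> * F) (Suc k) = 1728"
    using fps_mult_nth_lowest(1)[of 1 \<Delta> k F] F \<Delta> by simp
  ultimately have "of_int (6 * int k + 5) * g + (12 * of_nat (Suc k) - of_int (6 * int k + 5)) * g =
         of_int (6 * int k + 5) * (of_int (6 * int k + 1) * 1728)"
    by (simp only:)
  then have "12 * (of_nat (Suc k) * g) = 12 * (144 * of_nat (6 * k + 1) * of_nat (6 * k + 5))"
    by (simp add: algebra_simps)
  then have *: "of_nat (Suc k) * g = 144 * of_nat (6 * k + 1) * of_nat (6 * k + 5)"
    by (simp only: mult_cancel_left) simp
  define a b :: complex where "a = of_nat (6 * k + 1)" and "b = of_nat (6 * k + 5)"
  have ab: "a \<noteq> 0" "b \<noteq> 0"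
    unfolding a_def b_def of_nat_eq_0_iff by simp_all
  have "c * g = of_nat (Suc k) * g / (144 * a * b)"
    by (simp add: c_def a_def b_def)
  also have "\<dots> = 1"
    unfolding * a_def[symmetric] b_def[symmetric] using ab by simp
  finally have "c * g = 1" .
  then show ?case unfolding FS using G0 by (auto simp: g_def)
qed auto

section \<open>Dimension and integrality\<close>

lemma quasimodular_fps_eq_quasimodular_forms:
  assumes "even w"
  shows "quasimodular_forms_1 w = hfun ` quasimodular_fps w"
proof -
  have eq: "hfun (a + b * E2) = hfun a + hfun b * eisenstein_E2" if "a \<in> disc_fps" "b \<in> disc_fps" for a b
    using that by (auto simp: fun_eq_iff hfun_E2[symmetric] hfun_simps hfun_def[of _ z for z]
        eval_fps_add eval_fps_mult disc_fps_conv_radius nome_in_disc)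
  have "even (w - 2)" using assms by simp
  then have "quasimodular_forms_1 w =
      {hfun a + hfun b * eisenstein_E2 | a b. a \<in> modular_fps w \<and> b \<in> modular_fps (w - 2)}"
    unfolding quasimodular_forms_1_def modular_forms_eq_modular_fps[OF assms] modular_forms_eq_modular_fps[OF \<open>even (w - 2)\<close>]
    by blast
  also have "\<dots> = hfun ` quasimodular_fps w"
    unfolding quasimodular_fps_def using eq modular_fps_disc_fps by (auto simp: image_def) metis+
  finally show ?thesis .
qed

lemma hfun_scale_add:
  assumes "A \<in> disc_fps" "B \<in> disc_fps"
  shows "hfun (A + fps_const c * B) = hfun A + (\<lambda>z. c * hfun B z)"
  using assms
  by (auto simp: fun_eq_iff hfun_def eval_fps_add eval_fps_mult disc_fps_conv_radius nome_in_disc)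

lemma hfun_sum_scale:
  assumes "finite I" "\<And>i. i \<in> I \<Longrightarrow> B i \<in> disc_fps"
  shows "(\<Sum>i\<in>I. fps_const (c i) * B i) \<in> disc_fps"
    "hfun (\<Sum>i\<in>I. fps_const (c i) * B i) = (\<Sum>i\<in>I. (\<lambda>z. c i * hfun (B i) z))"
proof -
  have "(\<Sum>i\<in>I. fps_const (c i) * B i) \<in> disc_fps \<and>
    hfun (\<Sum>i\<in>I. fps_const (c i) * B i) = (\<Sum>i\<in>I. (\<lambda>z. c i * hfun (B i) z))"
    using assms
  proof (induction I rule: finite_induct)
    case empty
    show ?case by (auto simp: fun_eq_iff hfun_def)
  next
    case (insert i I)
    then show ?case by (auto simp: add.commute[of "fps_const _ * _"] hfun_scale_add)
  qed
  then show "(\<Sum>i\<in>I. fps_const (c i) * B i) \<in> disc_fps"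
    "hfun (\<Sum>i\<in>I. fps_const (c i) * B i) = (\<Sum>i\<in>I. (\<lambda>z. c i * hfun (B i) z))" by auto
qed

text \<open>A basis of the quasimodular forms of weight \<open>6k + 4\<close> with orders \<open>0, \<dots>, k\<close> at the cusp.\<close>

definition echelon_fps :: "nat \<Rightarrow> nat \<Rightarrow> complex fps" where
  "echelon_fps k j = E4 * (E6 ^ (k - j) * extremal_fps j)"

lemma E6_power_modular_fps: "E6 ^ n \<in> modular_fps (6 * int n)"
  by (induction n) (auto simp: modular_fps_1 intro!: modular_fps_mult[OF E6_modular_fps])

lemma echelon_fps_quasimodular_fps:
  assumes "j \<le> k"
  shows "echelon_fps k j \<in> quasimodular_fps (6 * int k + 4)"
  unfolding echelon_fps_def
  by (rule quasimodular_fps_mult[OF E4_modular_fps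
        quasimodular_fps_mult[OF E6_power_modular_fps extremal_fps_quasimodular_fps refl]])
    (use assms in auto)

lemma echelon_fps_nth:
  "\<And>i. i < j \<Longrightarrow> fps_nth (echelon_fps k j) i = 0" "fps_nth (echelon_fps k j) j = 1"
proof -
  have 1: "\<And>i. i < j \<Longrightarrow> fps_nth (extremal_fps j) i = 0" using extremal_fps_nth by blast
  note 2 = fps_mult_nth_order(2)[OF 1]
  show "\<And>i. i < j \<Longrightarrow> fps_nth (echelon_fps k j) i = 0"
    unfolding echelon_fps_def by (rule fps_mult_nth_order(2)[OF 2])
  show "fps_nth (echelon_fps k j) j = 1"
    using extremal_fps_nth[of j] fps_mult_nth_order(1)[of j "extremal_fps j" "E6 ^ (k - j)", OF 1]
      fps_mult_nth_order(1)[of j "E6 ^ (k - j) * extremal_fps j" E4, OF 2]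
    by (simp add: echelon_fps_def fps_power_zeroth)
qed

text \<open>Subtracting multiples of the echelon elements raises the order at the cusp step by step
  until \<open>quasimodular_fps_valence\<close> leaves 0, so they span. Independence follows from
  their triangular shape.\<close>

theorem dim_quasimodular_forms:
  "cfun.dim (quasimodular_forms_1 (6 * int k + 4)) = k + 1"
proof -
  let ?w = "6 * int k + 4"
  let ?b = "\<lambda>j. hfun (echelon_fps k j)"
  let ?B = "?b ` {..k}"
  have disc: "echelon_fps k j \<in> disc_fps" if "j \<le> k" for j
    using quasimodular_fps_disc_fps[OF echelon_fps_quasimodular_fps[OF that]] .
  have V: "quasimodular_forms_1 ?w = hfun ` quasimodular_fps ?w"
    by (rule quasimodular_fps_eq_quasimodular_forms) simp
  have inj: "inj_on ?b {..k}"
  proof (rule inj_onI)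
    fix i j assume ij: "i \<in> {..k}" "j \<in> {..k}" "?b i = ?b j"
    then have eq: "echelon_fps k i = echelon_fps k j" using hfun_inject disc by auto
    show "i = j"
    proof (rule ccontr)
      assume "i \<noteq> j"
      then consider "i < j" | "j < i" by linarith
      then show False using echelon_fps_nth(1)[of _ _ k] echelon_fps_nth(2)[of k] eq by cases (metis zero_neq_one)+
    qed
  qed
  have span: "hfun A \<in> cfun.span ?B"
    if "A \<in> quasimodular_fps ?w" "\<And>i. i < n \<Longrightarrow> fps_nth A i = 0" "n \<le> Suc k" for n A
    using that(3) that(1,2)
  proof (induction n arbitrary: A rule: inc_induct)
    case base
    then have "A = 0" using quasimodular_fps_valence[of A k] by (simp add: less_Suc_eq_le)
    then have "hfun A = 0" by (auto simp: fun_eq_iff hfun_def)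
    then show ?case by (simp only: cfun.span_zero)
  next
    case (step n)
    define c where "c = fps_nth A n"
    define A' where "A' = A - fps_const c * echelon_fps k n"
    have n: "n \<le> k" using step by simp
    have A': "A' \<in> quasimodular_fps ?w"
      unfolding A'_def
      by (intro quasimodular_fps_diff quasimodular_fps_const_mult echelon_fps_quasimodular_fps step.prems n)
    moreover have "fps_nth A' i = 0" if "i < Suc n" for i
      using that step.prems(2) echelon_fps_nth(1)[of _ n k] echelon_fps_nth(2)[of k n]
      by (cases "i = n") (auto simp: A'_def c_def)
    ultimately have "hfun A' \<in> cfun.span ?B" by (rule step.IH)
    moreover have "(\<lambda>z. c * ?b n z) \<in> cfun.span ?B"
      using n by (intro cfun.span_scale cfun.span_base) auto
    moreover have "hfun A = hfun A' + (\<lambda>z. c * ?b n z)"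
      using hfun_scale_add[OF quasimodular_fps_disc_fps[OF A'] disc[OF n], of c]
      by (simp add: A'_def)
    ultimately show ?case by (metis cfun.span_add)
  qed
  have ind: "cfun.independent ?B"
  proof (rule cfun.independent_if_scalars_zero)
    fix c f assume 0: "(\<Sum>f\<in>?B. (\<lambda>z. c f * f z)) = 0" and f: "f \<in> ?B"
    define d where "d j = c (?b j)" for j
    have "(\<Sum>j\<le>k. (\<lambda>z. d j * ?b j z)) = 0"
      using 0 unfolding sum.reindex[OF inj] by (simp add: d_def o_def)
    then have "hfun (\<Sum>j\<le>k. fps_const (d j) * echelon_fps k j) = hfun 0"
      using hfun_sum_scale(2)[of "{..k}" "echelon_fps k" d] disc
      by (auto simp: fun_eq_iff hfun_def)
    then have "(\<Sum>j\<le>k. fps_const (d j) * echelon_fps k j) = 0"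
      using disc by (intro hfun_inject hfun_sum_scale) auto
    from arg_cong[OF this, of fps_nth]
    have sum0: "(\<Sum>j\<le>k. d j * fps_nth (echelon_fps k j) i) = 0" for i
      by (simp add: fun_eq_iff fps_sum_nth)
    have "d j = 0" if "j \<le> k" for j
      using that
    proof (induction j rule: less_induct)
      case (less j)
      \<comment> \<open>Terms with \<open>i < j\<close> vanish by induction, those with
        \<open>i > j\<close> by the order of the echelon elements.\<close>
      have "(\<Sum>i\<le>k. d i * fps_nth (echelon_fps k i) j) = (\<Sum>i\<in>{j}. d i * fps_nth (echelon_fps k i) j)"
      proof (intro sum.mono_neutral_right ballI)
        fix i assume "i \<in> {..k} - {j}"
        then show "d i * fps_nth (echelon_fps k i) j = 0"
          using less echelon_fps_nth(1)[of j i k] by (cases "i < j") auto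
      qed (use less.prems in auto)
      then show ?case using sum0[of j] echelon_fps_nth(2)[of k j] by simp
    qed
    then show "c f = 0" using f by (auto simp: d_def)
  qed simp
  show ?thesis
  proof (rule cfun.dim_unique[OF _ _ ind])
    show "?B \<subseteq> quasimodular_forms_1 ?w" unfolding V using echelon_fps_quasimodular_fps by auto
    show "quasimodular_forms_1 ?w \<subseteq> cfun.span ?B" unfolding V using span[of _ 0] by auto
    show "card ?B = k + 1" using card_image[OF inj] by simp
  qed
qed

section \<open>Denominators of the coefficients\<close>

definition Z_inv :: "nat \<Rightarrow> complex set" where
  "Z_inv N = of_rat ` Z_inverse_primes_below N"

lemma Z_inv_intros:
  shows Z_inv_1: "1 \<in> Z_inv N"
    and Z_inv_diff: "x \<in> Z_inv N \<Longrightarrow> y \<in> Z_inv N \<Longrightarrow> x - y \<in> Z_inv N"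
    and Z_inv_mult: "x \<in> Z_inv N \<Longrightarrow> y \<in> Z_inv N \<Longrightarrow> x * y \<in> Z_inv N"
    and Z_inv_of_int: "of_int n \<in> Z_inv N"
    and Z_inv_prime: "prime p \<Longrightarrow> p < N \<Longrightarrow> 1 / of_nat p \<in> Z_inv N"
proof -
  have rat: "of_rat r \<in> Z_inv N" if "r \<in> Z_inverse_primes_below N" for r
    using that by (simp add: Z_inv_def)
  have "1 \<in> Z_inverse_primes_below N"
    unfolding Z_inverse_primes_below_def by (rule subring_generated.one)
  from rat[OF this] show "1 \<in> Z_inv N" by simp
  show "x - y \<in> Z_inv N" "x * y \<in> Z_inv N" if "x \<in> Z_inv N" "y \<in> Z_inv N" for x y
    using that unfolding Z_inv_def Z_inverse_primes_below_def
    by (auto simp flip: of_rat_diff of_rat_mult intro: subring_generated.diff subring_generated.mult)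
  show "of_int n \<in> Z_inv N"
    using rat[of "of_int n"] subring_generated.base[of "of_int n :: rat"]
    by (auto simp: Z_inverse_primes_below_def)
  show "1 / of_nat p \<in> Z_inv N" if "prime p" "p < N"
  proof -
    have "1 / of_nat p \<in> Z_inverse_primes_below N"
      unfolding Z_inverse_primes_below_def using that by (intro subring_generated.base) blast
    from rat[OF this] show ?thesis by (simp add: of_rat_divide)
  qed
qed

lemma Z_inv_of_nat: "of_nat n \<in> Z_inv N"
  using Z_inv_of_int[of "int n" N] by simp

lemma Z_inv_0: "0 \<in> Z_inv N"
  using Z_inv_of_int[of 0 N] by simp

lemma Z_inv_sum: "(\<And>i. i \<in> I \<Longrightarrow> f i \<in> Z_inv N) \<Longrightarrow> sum f I \<in> Z_inv N"
proof (induction I rule: infinite_finite_induct)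
  case (insert i I)
  then have "f i - (0 - sum f I) \<in> Z_inv N" by (intro Z_inv_diff Z_inv_0) auto
  then show ?case using insert by simp
qed (auto simp: Z_inv_0)

lemma Z_inv_inverse:
  assumes "0 < n" "n < N"
  shows "1 / of_nat n \<in> Z_inv N"
  using assms
proof (induction n rule: less_induct)
  case (less n)
  show ?case
  proof (cases "n = 1")
    case True
    then show ?thesis by (simp add: Z_inv_1)
  next
    case False
    then obtain p where p: "prime p" "p dvd n" using prime_factor_nat by blast
    then obtain m where m: "n = p * m" by (auto elim: dvdE)
    with less.prems have m0: "m > 0" by auto
    have "p > 1" using p prime_gt_1_nat by blast
    with m m0 have "m < n" by simp
    moreover have "p \<le> n" using m m0 by simp
    ultimately have "1 / of_nat p * (1 / of_nat m) \<in> Z_inv N"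
      using less m0 p by (intro Z_inv_mult Z_inv_prime less.IH) auto
    then show ?thesis by (simp add: m)
  qed
qed

lemma Z_inv_mono:
  assumes "M \<le> N"
  shows "Z_inv M \<subseteq> Z_inv N"
proof -
  have "x \<in> Z_inverse_primes_below N" if "x \<in> Z_inverse_primes_below M" for x
    using that unfolding Z_inverse_primes_below_def
  proof induction
    case (base x)
    then show ?case using assms by (intro subring_generated.base) force
  qed (auto intro: subring_generated.intros)
  then show ?thesis by (auto simp: Z_inv_def)
qed

definition Z_inv_fps :: "nat \<Rightarrow> complex fps set" where
  "Z_inv_fps N = {A. \<forall>n. fps_nth A n \<in> Z_inv N}"

lemma Z_inv_fps_diff: "A \<in> Z_inv_fps N \<Longrightarrow> B \<in> Z_inv_fps N \<Longrightarrow> A - B \<in> Z_inv_fps N"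
  by (auto simp: Z_inv_fps_def intro: Z_inv_diff)

lemma Z_inv_fps_mult: "A \<in> Z_inv_fps N \<Longrightarrow> B \<in> Z_inv_fps N \<Longrightarrow> A * B \<in> Z_inv_fps N"
  by (auto simp: Z_inv_fps_def fps_mult_nth intro!: Z_inv_sum Z_inv_mult)

lemma Z_inv_fps_const: "c \<in> Z_inv N \<Longrightarrow> fps_const c \<in> Z_inv_fps N"
  by (auto simp: Z_inv_fps_def Z_inv_0)

lemma Z_inv_fps_of_int: "of_int c \<in> Z_inv_fps N"
  using Z_inv_fps_const[OF Z_inv_of_int] by (simp add: fps_of_int)

lemma Z_inv_fps_numeral: "numeral c \<in> Z_inv_fps N"
  using Z_inv_fps_of_int[of "numeral c"] by simp

lemma Z_inv_fps_qD: "A \<in> Z_inv_fps N \<Longrightarrow> qD A \<in> Z_inv_fps N"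
  by (auto simp: Z_inv_fps_def intro!: Z_inv_mult Z_inv_of_nat)

lemmas Z_inv_fps_intros =
  Z_inv_fps_diff Z_inv_fps_mult Z_inv_fps_of_int Z_inv_fps_numeral Z_inv_fps_qD

lemma Z_inv_fps_Eisenstein:
  "E2 \<in> Z_inv_fps N" "E4 \<in> Z_inv_fps N" "E6 \<in> Z_inv_fps N"
proof -
  have "fps_nth E2 n = of_int (if n = 0 then 1 else - 24 * int (divisor_sum 1 n))" for n
    by (simp add: E2_def)
  then show 2: "E2 \<in> Z_inv_fps N"
    by (simp only: Z_inv_fps_def Z_inv_of_int mem_Collect_eq simp_thms)
  then show 4: "E4 \<in> Z_inv_fps N" unfolding E4_eq by (intro Z_inv_fps_intros)
  with 2 show "E6 \<in> Z_inv_fps N" unfolding E6_eq by (intro Z_inv_fps_intros)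
qed

lemma extremal_fps_integral: "extremal_fps k \<in> Z_inv_fps (6 * k)"
proof (induction k)
  case 0
  show ?case using Z_inv_fps_of_int[of 1 0] by simp
next
  case (Suc k)
  let ?N = "6 * Suc k"
  have "Z_inv (6 * k) \<subseteq> Z_inv ?N" by (rule Z_inv_mono) simp
  with Suc have F: "extremal_fps k \<in> Z_inv_fps ?N" by (auto simp: Z_inv_fps_def)
  \<comment> \<open>144 is split as \<open>3^2 * 4^2\<close> because \<open>Z_inv_inverse\<close>
    needs each factor below \<open>6 (k + 1)\<close>, which is only 6 for \<open>k = 0\<close>. The
    largest factor, \<open>6 k + 5\<close>, just fits.\<close>
  have inv: "1 / of_nat 3 * (1 / of_nat 3) * (1 / of_nat 4 * (1 / of_nat 4)) * (1 / of_nat (6 * k + 1)) * (1 / of_nat (6 * k + 5))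
          * of_nat (Suc k) \<in> Z_inv ?N"
    by (intro Z_inv_mult Z_inv_inverse Z_inv_of_nat) auto
  have "of_nat (Suc k) / (144 * of_nat (6 * k + 1) * of_nat (6 * k + 5)) \<in> Z_inv ?N"
  proof -
    have "1 / of_nat 3 * (1 / of_nat 3) * (1 / of_nat 4 * (1 / of_nat 4)) * (1 / a) * (1 / b) * n
            = n / (144 * a * b)" for a b n :: complex by simp
    with inv show ?thesis by (simp only:)
  qed
  note c = Z_inv_fps_const[OF this]
  have "serre12 (6 * int k - 1) (extremal_fps k) \<in> Z_inv_fps ?N"
    unfolding serre12_def by (intro Z_inv_fps_intros Z_inv_fps_Eisenstein F)
  moreover have "of_nat (6 * k + 1) \<in> Z_inv_fps ?N"
    using Z_inv_fps_of_int[of "int (6 * k + 1)"] by simp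
  ultimately show ?case
    unfolding extremal_fps.simps
    by (intro Z_inv_fps_mult Z_inv_fps_diff Z_inv_fps_Eisenstein F c)
qed

theorem theorem1p9:
  fixes k :: nat and f :: "complex \<Rightarrow> complex"
  assumes "normalized_extremal_1 (6 * int k + 4) f"
  shows "\<forall>n. fourier_coeff f n \<in> of_rat ` Z_inverse_primes_below (6 * k)"
proof -
  let ?w = "6 * int k + 4"
  have ext: "depth_exactly_1 ?w f" "\<And>n. n < k \<Longrightarrow> fourier_coeff f n = 0" "fourier_coeff f k = 1"
    using assms
    by (auto simp: normalized_extremal_1_def extremal_1_def dim_quasimodular_forms Let_def)
  from ext(1) have "f \<in> quasimodular_forms_1 ?w"
    unfolding depth_exactly_1_def quasimodular_forms_1_def by blast
  then obtain A where A: "A \<in> quasimodular_fps ?w" "f = hfun A"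
    using quasimodular_fps_eq_quasimodular_forms[of ?w] by auto
  have coeff: "fourier_coeff f = fps_nth A"
    unfolding A(2) by (rule fourier_coeff_hfun[OF quasimodular_fps_disc_fps[OF A(1)]])
  \<comment> \<open>\<open>echelon_fps k k\<close> is \<open>E4 * extremal_fps k\<close>.
    Normalization at the index \<open>k\<close>, the dimension minus 1, makes the two series agree
    up to \<open>q^k\<close>, so the difference vanishes by the valence bound.\<close>
  have "A - echelon_fps k k = 0"
  proof (rule quasimodular_fps_valence[of _ k])
    show "A - echelon_fps k k \<in> quasimodular_fps ?w"
      by (intro quasimodular_fps_diff A echelon_fps_quasimodular_fps order_refl)
    fix i assume "i \<le> k"
    then show "fps_nth (A - echelon_fps k k) i = 0"
      using ext(2,3) echelon_fps_nth(1)[of _ k k] echelon_fps_nth(2)[of k k]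
      by (cases "i = k") (auto simp: coeff)
  qed
  then have "A = E4 * extremal_fps k" by (simp add: echelon_fps_def)
  then have "A \<in> Z_inv_fps (6 * k)"
    using Z_inv_fps_mult[OF Z_inv_fps_Eisenstein(2) extremal_fps_integral] by simp
  then show ?thesis unfolding coeff by (simp add: Z_inv_fps_def Z_inv_def)
qed

end
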